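(* For a smooth special isothermic surface of type $d$, images of a single point in the surface through a lattice of B\"acklund transforms will be a discrete special isothermic surface of type $d$. That is, if $f_{0,0}:\Sigma^2\to\mathbb{P}(\mathcal{L})$ is a smooth special isothermic surface of type $d$, $\{f_{m,n}\}_{m,n\ge 0}$ is a lattice of B\"acklund transforms of $f_{0,0}$, and $x\in\Sigma^2$ is a fixed point, then the discrete map $F_{(m,n)}:=f_{m,n}(x)$ is a discrete special isothermic surface of type $d$.
   Context: Ambient space. For non-negative integers $p,q$, $\mathbb{R}^{p+1,q+1}$ carries the metric $(\cdot,\cdot)$ of signature $(p+1,q+1)$ with light cone $\mathcal{L}$; $\mathbb{P}(\mathcal{L})$ is the conformal $(p,q)$-sphere. $\Sigma^2$ is simply connected. A surface $f:\Sigma^2\to\mathbb{P}(\mathcal{L})$ is also viewed as a null line subbundle of the trivial bundle $\Sigma^2\times\mathbb{R}^{p+1,q+1}$, and $\wedge^2\mathbb{R}^{p+1,q+1}$ is identified with $\mathfrak{o}(p+1,q+1)$. Lorentz boost. For non-orthogonal null lines $a,b$, $\Gamma_a^b(s)$ is the linear map acting as $s$ on $b$, as $s^{-1}$ on $a$, and as the identity on vectors orthogonal to both $a$ and $b$. Smooth isothermic surfaces. Surfaces are umbilic-free. $f$ is isothermic if it admits conformal curvature line coordinates; this holds exactly when there is a non-zero closed $1$-form $\eta\in\Omega^1(f\wedge f^\perp)$. The connections $\Gamma(t)=d+t\eta$ ($t\in\mathbb{R}$) are then flat and form the associated family of flat connections of $f$. Isothermic surfaces $f,\hat f$ are a Darboux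 pair with (finite) parameter $\mu$, and $\hat f$ is a Darboux transform of $f$, if $\hat f$ is $\Gamma(\mu)$-parallel; here $f$ and $\hat f$ are non-orthogonal. The associated family of $\hat f$ is then $\hat\Gamma(t)=\Gamma_f^{\hat f}(1-\tfrac t\mu)\circ\Gamma(t)\circ\Gamma_f^{\hat f}(1-\tfrac t\mu)^{-1}$. Special isothermic surfaces and B\"acklund transforms. A polynomial conserved quantity of $f$ of degree $d$ is a polynomial $p(t)=p^{(0)}+p^{(1)}t+\dots+p^{(d)}t^d$ with coefficients $p^{(\iota)}:\Sigma^2\to\mathbb{R}^{p+1,q+1}$ satisfying $\Gamma(t)p(t)=0$. If $f$ admits a polynomial conserved quantity of degree $d$, it is called special isothermic of type $d$. If $\hat f$ is a Darboux transform of such an $f$ with parameter $\mu$ and $p(\mu)\perp\hat f$, then $\hat f$ is called a B\"acklund transform of $f$ with parameter $\mu$; it is also special isothermic of type $d$, with conserved quantity $\hat p(t)=\Gamma_f^{\hat f}(1-\tfrac t\mu)p(t)$. Lattice of B\"acklund transforms. Permutability of Darboux transformations: if $f_j,f_\ell$ are Darboux transforms of $f_i$ with parameters $m_{ij}$ and $m_{i\ell}$, there is a fourth surface $f_k$ that is simultaneously a Darboux transform of $f_j$ with parameter $m_{i\ell}$ and of $f_\ell$ with parameter $m_{ij}$. A lattice of B\"acklund transforms of $f_{0,0}$ is a family $f_{m,n}$, $m,n\ge 0$, in which each $f_{m+1,0}$ is a B\"acklund transform of $f_{m,0}$, each $f_{0,n+1}$ is a B\"acklund transform of $f_{0,n}$,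 and all other $f_{m,n}$ are determined by permutability on the elementary quadrilaterals. Discrete surfaces. Let $D^2\subset\mathbb{Z}^2$ be simply connected (for example $(\mathbb{Z}_{\ge0})^2$), and write $i=(m,n)$, $j=(m+1,n)$, $k=(m+1,n+1)$, $\ell=(m,n+1)$ for the vertices of an elementary quadrilateral. A discrete surface $F:D^2\to\mathbb{P}(\mathcal{L})$ is assumed nondegenerate in all ways needed; in particular adjacent values are non-orthogonal. $F$ is discrete isothermic if for some real-valued non-vanishing edge-labeling on unoriented edges, with $m_{ij}=m_{\ell k}$ and $m_{i\ell}=m_{jk}$ on every elementary quadrilateral, the discrete connections $\Gamma(t)_{ji}:=\Gamma_{F_i}^{F_j}(1-\tfrac{t}{m_{ij}})$ are flat for all $t\in\mathbb{R}$, i.e. $\Gamma(t)_{kj}\Gamma(t)_{ji}=\Gamma(t)_{k\ell}\Gamma(t)_{\ell i}$. A polynomial $P(t)$ in $t$ with coefficients $P^{(\iota)}:D^2\to\mathbb{R}^{p+1,q+1}$ is a polynomial conserved quantity of $F$ if $\Gamma(t)_{ji}P(t)_i=P(t)_j$ on every edge $(ij)$; this condition is called the degree $d$ edge property, which is understood to imply that both $P(t)_i$ and $P(t)_j$ are polynomial of degree $d$. A discrete isothermic surface admitting a polynomial conserved quantity of degree $d$ is a discrete special isothermic surface of type $d$. *)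

theory Defs
  imports "HOL-Analysis.Analysis"
begin

section \<open>The conformal sphere of signature (p,q)\<close>

text \<open>
  Finite types are non-empty, so with index types of cardinality
  p + 1 and q + 1 the product below is R^(p+1,q+1) for arbitrary p, q \<ge> 0.
\<close>

type_synonym ('p, 'q) ambient = "(real^'p) \<times> (real^'q)"

definition pmetric :: "('p::finite, 'q::finite) ambient \<Rightarrow> ('p, 'q) ambient \<Rightarrow> real" where
  "pmetric v w = fst v \<bullet> fst w - snd v \<bullet> snd w"

definition light_cone :: "('p::finite, 'q::finite) ambient set" where
  "light_cone = {v. v \<noteq> 0 \<and> pmetric v v = 0}"

text \<open>Points of the projectivised light cone are one-dimensional null subspaces.\<close>

definition null_lines :: "('p::finite, 'q::finite) ambient set set" where
  "null_lines = {span {v} | v. v \<in> light_cone}"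

definition orthogonal_sets ::
    "('p::finite, 'q::finite) ambient set \<Rightarrow> ('p, 'q) ambient set \<Rightarrow> bool" where
  "orthogonal_sets A B \<longleftrightarrow> (\<forall>u\<in>A. \<forall>v\<in>B. pmetric u v = 0)"

definition wedge ::
    "('p::finite, 'q::finite) ambient \<Rightarrow> ('p, 'q) ambient \<Rightarrow> ('p, 'q) ambient \<Rightarrow> ('p, 'q) ambient" where
  "wedge u v = (\<lambda>w. pmetric u w *\<^sub>R v - pmetric v w *\<^sub>R u)"

text \<open>For a line \<open>a\<close> these decomposable elements already form a linear space.\<close>

definition wedge_perp ::
    "('p::finite, 'q::finite) ambient set \<Rightarrow> (('p, 'q) ambient \<Rightarrow> ('p, 'q) ambient) set" where
  "wedge_perp a = {wedge u v | u v. u \<in> a \<and> orthogonal_sets {v} a}"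

text \<open>
  \<open>boost a b s\<close> is the Lorentz boost \<open>\<Gamma>\<close> with lower index \<open>a\<close> and upper index \<open>b\<close>. It is
  meaningful for non-orthogonal null lines and \<open>s \<noteq> 0\<close>; see \<open>boost_span\<close> below.
\<close>

definition boost ::
    "('p::finite, 'q::finite) ambient set \<Rightarrow> ('p, 'q) ambient set \<Rightarrow> real
      \<Rightarrow> ('p, 'q) ambient \<Rightarrow> ('p, 'q) ambient" where
  "boost a b s = (THE L. linear L \<and> (\<forall>v\<in>b. L v = s *\<^sub>R v) \<and> (\<forall>v\<in>a. L v = inverse s *\<^sub>R v)
      \<and> (\<forall>v. orthogonal_sets {v} a \<and> orthogonal_sets {v} b \<longrightarrow> L v = v))"

lemma pmetric_commute: "pmetric v w = pmetric w v"
  by (simp add: pmetric_def inner_commute)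

lemma pmetric_add_left: "pmetric (u + v) w = pmetric u w + pmetric v w"
  by (simp add: pmetric_def inner_add_left)

lemma pmetric_diff_left: "pmetric (u - v) w = pmetric u w - pmetric v w"
  by (simp add: pmetric_def inner_diff_left)

lemma pmetric_scaleR_left: "pmetric (c *\<^sub>R v) w = c * pmetric v w"
  by (simp add: pmetric_def algebra_simps)

lemma pmetric_scaleR_right: "pmetric v (c *\<^sub>R w) = c * pmetric v w"
  by (simp add: pmetric_def algebra_simps)

lemma orthogonal_span_single: "orthogonal_sets {v} (span {u}) \<longleftrightarrow> pmetric v u = 0"
  by (auto simp: orthogonal_sets_def span_singleton pmetric_scaleR_right)

lemma boost_span:
  assumes u: "pmetric u u = 0" and w: "pmetric w w = 0" and uw: "pmetric u w \<noteq> 0"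
  shows "boost (span {u}) (span {w}) s =
    (\<lambda>v. v + ((inverse s - 1) * pmetric v w / pmetric u w) *\<^sub>R u
           + ((s - 1) * pmetric v u / pmetric u w) *\<^sub>R w)" (is "_ = ?L")
  unfolding boost_def
proof (rule the_equality, intro conjI ballI allI impI)
  show "linear ?L"
    by (rule linearI)
      (simp_all add: pmetric_add_left pmetric_scaleR_left algebra_simps add_divide_distrib
        diff_divide_distrib)
  show "?L v = s *\<^sub>R v" if "v \<in> span {w}" for v
    using that uw w
    by (auto simp: span_singleton pmetric_scaleR_left pmetric_commute[of w u]
        simp flip: scaleR_add_left) (simp add: algebra_simps)
  show "?L v = inverse s *\<^sub>R v" if "v \<in> span {u}" for v
    using that uw u
    by (auto simp: span_singleton pmetric_scaleR_left pmetric_commute[of w u]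
        simp flip: scaleR_add_left) (simp add: algebra_simps)
  show "?L v = v" if "orthogonal_sets {v} (span {u}) \<and> orthogonal_sets {v} (span {w})" for v
    using that by (simp add: orthogonal_span_single)
next
  fix L
  assume L: "linear L \<and> (\<forall>v\<in>span {w}. L v = s *\<^sub>R v) \<and> (\<forall>v\<in>span {u}. L v = inverse s *\<^sub>R v)
      \<and> (\<forall>v. orthogonal_sets {v} (span {u}) \<and> orthogonal_sets {v} (span {w}) \<longrightarrow> L v = v)"
  then interpret linear L by simp
  show "L = ?L"
  proof
    fix v
    define a b where "a = pmetric v w / pmetric u w" and "b = pmetric v u / pmetric u w"
    define z where "z = v - a *\<^sub>R u - b *\<^sub>R w"
    have "pmetric z u = 0" "pmetric z w = 0"
      using u w uw by (simp_all add: z_def a_def b_def pmetric_diff_left pmetric_scaleR_left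
          pmetric_commute[of w u])
    then have z: "L z = z"
      using L unfolding orthogonal_span_single by blast
    have "L u = inverse s *\<^sub>R u" "L w = s *\<^sub>R w"
      using L by (auto simp: span_base)
    moreover have "v = z + a *\<^sub>R u + b *\<^sub>R w"
      by (simp add: z_def)
    ultimately have "L v = z + (a * inverse s) *\<^sub>R u + (b * s) *\<^sub>R w"
      using z by (simp add: add scale del: scaleR_scaleR) simp
    also have "\<dots> = v + ((inverse s - 1) * a) *\<^sub>R u + ((s - 1) * b) *\<^sub>R w"
      unfolding z_def left_diff_distrib scaleR_diff_left mult_1_left
      by (simp add: mult.commute del: scaleR_scaleR)
    finally show "L v = ?L v"
      by (simp add: a_def b_def)
  qed
qed


section \<open>Smooth maps and surfaces\<close>

definition dderiv :: "'a::real_normed_vector \<Rightarrow> ('a \<Rightarrow> 'b::real_normed_vector) \<Rightarrow> 'a \<Rightarrow> 'b" where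
  "dderiv X f y = frechet_derivative f (at y) X"

primrec Ck_on :: "nat \<Rightarrow> 'a::real_normed_vector set \<Rightarrow> ('a \<Rightarrow> 'b::real_normed_vector) \<Rightarrow> bool" where
  "Ck_on 0 D f \<longleftrightarrow> continuous_on D f"
| "Ck_on (Suc k) D f \<longleftrightarrow> (\<forall>y\<in>D. f differentiable at y) \<and> (\<forall>X. Ck_on k D (dderiv X f))"

definition smooth_on :: "'a::real_normed_vector set \<Rightarrow> ('a \<Rightarrow> 'b::real_normed_vector) \<Rightarrow> bool" where
  "smooth_on D f \<longleftrightarrow> (\<forall>k. Ck_on k D f)"

text \<open>
  Charts are given by their inverses: a pair of an open set \<open>D\<close> of the plane and a
  parametrisation \<open>\<kappa>\<close> of an open piece of the surface; the values of \<open>\<kappa>\<close> off \<open>D\<close> are irrelevant.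
\<close>

type_synonym 's chart = "(real^2) set \<times> (real^2 \<Rightarrow> 's)"

definition is_chart :: "'s::topological_space set \<Rightarrow> 's chart \<Rightarrow> bool" where
  "is_chart \<Sigma> = (\<lambda>(D, \<kappa>). open D \<and> openin (top_of_set \<Sigma>) (\<kappa> ` D)
      \<and> homeomorphism D (\<kappa> ` D) \<kappa> (inv_into D \<kappa>))"

definition overlap :: "'s chart \<Rightarrow> 's chart \<Rightarrow> (real^2) set" where
  "overlap = (\<lambda>(D, \<kappa>) (D', \<kappa>'). {y \<in> D. \<kappa> y \<in> \<kappa>' ` D'})"

definition transition :: "'s chart \<Rightarrow> 's chart \<Rightarrow> real^2 \<Rightarrow> real^2" where
  "transition = (\<lambda>(D, \<kappa>) (D', \<kappa>') y. inv_into D' \<kappa>' (\<kappa> y))"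

definition is_atlas :: "'s::topological_space set \<Rightarrow> 's chart set \<Rightarrow> bool" where
  "is_atlas \<Sigma> \<A> \<longleftrightarrow> (\<forall>c\<in>\<A>. is_chart \<Sigma> c) \<and> (\<Union>(D, \<kappa>)\<in>\<A>. \<kappa> ` D) = \<Sigma>
      \<and> (\<forall>c\<in>\<A>. \<forall>c'\<in>\<A>. smooth_on (overlap c c') (transition c c'))"

text \<open>A smooth surface: a Hausdorff second countable space with a maximal smooth atlas.\<close>

definition smooth_surface ::
    "'s::{t2_space, second_countable_topology} set \<Rightarrow> 's chart set \<Rightarrow> bool" where
  "smooth_surface \<Sigma> \<A> \<longleftrightarrow> is_atlas \<Sigma> \<A> \<and> (\<forall>c. is_atlas \<Sigma> (insert c \<A>) \<longrightarrow> c \<in> \<A>)"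

text \<open>
  One-forms on the surface with values in the endomorphisms of the ambient space, given by
  their coordinate expressions: \<open>\<eta> c y X v\<close> is the value at the point with coordinates \<open>y\<close> in
  the chart \<open>c\<close>, on the tangent vector \<open>X\<close>, applied to \<open>v\<close>.
\<close>

type_synonym ('s, 'p, 'q) end_form =
  "'s chart \<Rightarrow> real^2 \<Rightarrow> real^2 \<Rightarrow> ('p, 'q) ambient \<Rightarrow> ('p, 'q) ambient"

definition is_one_form :: "'s chart set \<Rightarrow> ('s, 'p::finite, 'q::finite) end_form \<Rightarrow> bool" where
  "is_one_form \<A> \<eta> \<longleftrightarrow>
     (\<forall>c\<in>\<A>. (\<forall>X v. smooth_on (fst c) (\<lambda>y. \<eta> c y X v))
        \<and> (\<forall>y\<in>fst c. (\<forall>v. linear (\<lambda>X. \<eta> c y X v)) \<and> (\<forall>X. linear (\<eta> c y X))))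
   \<and> (\<forall>c\<in>\<A>. \<forall>c'\<in>\<A>. \<forall>y\<in>overlap c c'. \<forall>X.
        \<eta> c y X = \<eta> c' (transition c c' y) (dderiv X (transition c c') y))"

definition closed_form :: "'s chart set \<Rightarrow> ('s, 'p::finite, 'q::finite) end_form \<Rightarrow> bool" where
  "closed_form \<A> \<eta> \<longleftrightarrow> (\<forall>c\<in>\<A>. \<forall>y\<in>fst c. \<forall>X Y v.
     dderiv X (\<lambda>z. \<eta> c z Y v) y = dderiv Y (\<lambda>z. \<eta> c z X v) y)"


section \<open>Smooth isothermic surfaces\<close>

text \<open>\<open>lift_on U f \<psi>\<close>: the map \<open>\<psi>\<close> is a smooth nowhere vanishing section of the null line bundle \<open>f\<close>
  over the coordinate domain \<open>U\<close>.\<close>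

definition lift_on :: "(real^2) set \<Rightarrow> (real^2 \<Rightarrow> ('p::finite, 'q::finite) ambient set)
    \<Rightarrow> (real^2 \<Rightarrow> ('p, 'q) ambient) \<Rightarrow> bool" where
  "lift_on U f \<psi> \<longleftrightarrow> open U \<and> smooth_on U \<psi> \<and> (\<forall>y\<in>U. \<psi> y \<in> light_cone \<and> f y = span {\<psi> y})"

definition smooth_line_map ::
    "'s chart set \<Rightarrow> ('s \<Rightarrow> ('p::finite, 'q::finite) ambient set) \<Rightarrow> bool" where
  "smooth_line_map \<A> f \<longleftrightarrow>
     (\<forall>(D, \<kappa>)\<in>\<A>. \<forall>y\<in>D. \<exists>U \<psi>. y \<in> U \<and> U \<subseteq> D \<and> lift_on U (f \<circ> \<kappa>) \<psi>)"

definition partial_u :: "(real^2 \<Rightarrow> 'b::real_normed_vector) \<Rightarrow> real^2 \<Rightarrow> 'b" where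
  "partial_u = dderiv (axis 1 1)"

definition partial_v :: "(real^2 \<Rightarrow> 'b::real_normed_vector) \<Rightarrow> real^2 \<Rightarrow> 'b" where
  "partial_v = dderiv (axis 2 1)"

definition tangent_space :: "(real^2 \<Rightarrow> ('p::finite, 'q::finite) ambient) \<Rightarrow> real^2
    \<Rightarrow> ('p, 'q) ambient set" where
  "tangent_space \<psi> y = span {\<psi> y, partial_u \<psi> y, partial_v \<psi> y}"

text \<open>
  Umbilics: the second fundamental form is a multiple of the induced metric. Modulo
  \<open>tangent_space \<psi> y\<close> the second derivatives of a lift represent the second fundamental form
  together with the induced metric itself, and rescaling the lift or changing coordinates only
  rescales the vector \<open>H\<close> and transforms both sides as bilinear forms.
\<close>

definition umbilic :: "(real^2 \<Rightarrow> ('p::finite, 'q::finite) ambient) \<Rightarrow> real^2 \<Rightarrow> bool" where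
  "umbilic \<psi> y \<longleftrightarrow> (\<exists>H. \<forall>X Y.
     dderiv X (dderiv Y \<psi>) y - pmetric (dderiv X \<psi> y) (dderiv Y \<psi> y) *\<^sub>R H \<in> tangent_space \<psi> y)"

definition umbilic_free ::
    "'s chart set \<Rightarrow> ('s \<Rightarrow> ('p::finite, 'q::finite) ambient set) \<Rightarrow> bool" where
  "umbilic_free \<A> f \<longleftrightarrow>
     (\<forall>(D, \<kappa>)\<in>\<A>. \<forall>U \<psi>. U \<subseteq> D \<and> lift_on U (f \<circ> \<kappa>) \<psi> \<longrightarrow> (\<forall>y\<in>U. \<not> umbilic \<psi> y))"

text \<open>
  The sign \<open>\<epsilon>\<close> is 1 for a definite and -1 for an indefinite induced conformal structure. The
  mixed derivative is tangential precisely when all second fundamental forms are diagonal.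
\<close>

definition conformal_curvature_line ::
    "(real^2) set \<Rightarrow> (real^2 \<Rightarrow> ('p::finite, 'q::finite) ambient) \<Rightarrow> bool" where
  "conformal_curvature_line D \<psi> \<longleftrightarrow> (\<exists>\<epsilon>\<in>{1, -1}. \<forall>y\<in>D.
       pmetric (partial_u \<psi> y) (partial_u \<psi> y) \<noteq> 0
     \<and> pmetric (partial_v \<psi> y) (partial_v \<psi> y) = \<epsilon> * pmetric (partial_u \<psi> y) (partial_u \<psi> y)
     \<and> pmetric (partial_u \<psi> y) (partial_v \<psi> y) = 0
     \<and> partial_u (partial_v \<psi>) y \<in> tangent_space \<psi> y)"

definition isothermic :: "'s set \<Rightarrow> 's chart set
    \<Rightarrow> ('s \<Rightarrow> ('p::finite, 'q::finite) ambient set) \<Rightarrow> bool" where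
  "isothermic \<Sigma> \<A> f \<longleftrightarrow> smooth_line_map \<A> f \<and> umbilic_free \<A> f
     \<and> (\<forall>x\<in>\<Sigma>. \<exists>(D, \<kappa>)\<in>\<A>. x \<in> \<kappa> ` D
          \<and> (\<exists>\<psi>. lift_on D (f \<circ> \<kappa>) \<psi> \<and> conformal_curvature_line D \<psi>))"

definition isothermic_form :: "'s chart set
    \<Rightarrow> ('s \<Rightarrow> ('p::finite, 'q::finite) ambient set) \<Rightarrow> ('s, 'p, 'q) end_form \<Rightarrow> bool" where
  "isothermic_form \<A> f \<eta> \<longleftrightarrow> is_one_form \<A> \<eta> \<and> closed_form \<A> \<eta>
     \<and> (\<forall>(D, \<kappa>)\<in>\<A>. \<forall>y\<in>D. \<forall>X. \<eta> (D, \<kappa>) y X \<in> wedge_perp (f (\<kappa> y)))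
     \<and> (\<exists>c\<in>\<A>. \<exists>y\<in>fst c. \<exists>X v. \<eta> c y X v \<noteq> 0)"

text \<open>
  \<open>connection (\<eta> c) t s y X\<close> is the covariant derivative at \<open>y\<close> in direction \<open>X\<close> of the section
  \<open>s\<close>, expressed in the chart \<open>c\<close>, with respect to \<open>d + t \<eta>\<close>.
\<close>

definition connection ::
    "(real^2 \<Rightarrow> real^2 \<Rightarrow> ('p::finite, 'q::finite) ambient \<Rightarrow> ('p, 'q) ambient) \<Rightarrow> real
      \<Rightarrow> (real^2 \<Rightarrow> ('p, 'q) ambient) \<Rightarrow> real^2 \<Rightarrow> real^2 \<Rightarrow> ('p, 'q) ambient" where
  "connection \<eta> t s y X = dderiv X s y + t *\<^sub>R \<eta> y X (s y)"

definition parallel_line :: "'s chart set \<Rightarrow> ('s, 'p::finite, 'q::finite) end_form \<Rightarrow> real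
    \<Rightarrow> ('s \<Rightarrow> ('p, 'q) ambient set) \<Rightarrow> bool" where
  "parallel_line \<A> \<eta> t g \<longleftrightarrow>
     (\<forall>(D, \<kappa>)\<in>\<A>. \<forall>U \<psi>. U \<subseteq> D \<and> lift_on U (g \<circ> \<kappa>) \<psi> \<longrightarrow>
        (\<forall>y\<in>U. \<forall>X. connection (\<eta> (D, \<kappa>)) t \<psi> y X \<in> g (\<kappa> y)))"

text \<open>
  The associated family of \<open>g\<close> is the gauge transform of that of \<open>f\<close>. This fixes the constant
  factor in the choice of the form \<open>\<eta>'\<close> of \<open>g\<close>.
\<close>

definition gauge_related :: "'s chart set \<Rightarrow> real
    \<Rightarrow> ('s \<Rightarrow> ('p::finite, 'q::finite) ambient set) \<Rightarrow> ('s, 'p, 'q) end_form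
    \<Rightarrow> ('s \<Rightarrow> ('p, 'q) ambient set) \<Rightarrow> ('s, 'p, 'q) end_form \<Rightarrow> bool" where
  "gauge_related \<A> \<mu> f \<eta> g \<eta>' \<longleftrightarrow>
     (\<forall>(D, \<kappa>)\<in>\<A>. \<forall>t. t \<noteq> \<mu> \<longrightarrow> (\<forall>U s. open U \<and> U \<subseteq> D \<and> smooth_on U s \<longrightarrow>
        (\<forall>y\<in>U. \<forall>X.
           connection (\<eta>' (D, \<kappa>)) t (\<lambda>z. boost (f (\<kappa> z)) (g (\<kappa> z)) (1 - t / \<mu>) (s z)) y X
         = boost (f (\<kappa> y)) (g (\<kappa> y)) (1 - t / \<mu>) (connection (\<eta> (D, \<kappa>)) t s y X))))"

definition darboux_transform :: "'s set \<Rightarrow> 's chart set \<Rightarrow> real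
    \<Rightarrow> ('s \<Rightarrow> ('p::finite, 'q::finite) ambient set) \<Rightarrow> ('s, 'p, 'q) end_form
    \<Rightarrow> ('s \<Rightarrow> ('p, 'q) ambient set) \<Rightarrow> ('s, 'p, 'q) end_form \<Rightarrow> bool" where
  "darboux_transform \<Sigma> \<A> \<mu> f \<eta> g \<eta>' \<longleftrightarrow> \<mu> \<noteq> 0
     \<and> isothermic \<Sigma> \<A> f \<and> isothermic_form \<A> f \<eta>
     \<and> isothermic \<Sigma> \<A> g \<and> isothermic_form \<A> g \<eta>'
     \<and> (\<forall>x\<in>\<Sigma>. \<not> orthogonal_sets (f x) (g x))
     \<and> parallel_line \<A> \<eta> \<mu> g
     \<and> gauge_related \<A> \<mu> f \<eta> g \<eta>'"


section \<open>Special isothermic surfaces and lattices of Baecklund transforms\<close>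

definition poly_eval :: "nat \<Rightarrow> (nat \<Rightarrow> 'v::real_vector) \<Rightarrow> real \<Rightarrow> 'v" where
  "poly_eval d p t = (\<Sum>k\<le>d. t ^ k *\<^sub>R p k)"

text \<open>
  The coefficients of \<open>p\<close> are functions on the surface, so that degree \<open>d\<close> means that the
  function \<open>\<lambda>x. p x d\<close> is not identically zero.
\<close>

definition conserved_quantity :: "'s set \<Rightarrow> 's chart set \<Rightarrow> nat
    \<Rightarrow> ('s, 'p::finite, 'q::finite) end_form \<Rightarrow> ('s \<Rightarrow> nat \<Rightarrow> ('p, 'q) ambient) \<Rightarrow> bool" where
  "conserved_quantity \<Sigma> \<A> d \<eta> p \<longleftrightarrow>
     (\<forall>(D, \<kappa>)\<in>\<A>. \<forall>k\<le>d. smooth_on D (\<lambda>z. p (\<kappa> z) k))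
   \<and> (\<forall>t. \<forall>(D, \<kappa>)\<in>\<A>. \<forall>y\<in>D. \<forall>X.
        connection (\<eta> (D, \<kappa>)) t (\<lambda>z. poly_eval d (p (\<kappa> z)) t) y X = 0)
   \<and> (\<exists>x\<in>\<Sigma>. p x d \<noteq> 0)"

definition special_isothermic :: "'s set \<Rightarrow> 's chart set \<Rightarrow> nat
    \<Rightarrow> ('s \<Rightarrow> ('p::finite, 'q::finite) ambient set) \<Rightarrow> bool" where
  "special_isothermic \<Sigma> \<A> d f \<longleftrightarrow> isothermic \<Sigma> \<A> f
     \<and> (\<exists>\<eta> p. isothermic_form \<A> f \<eta> \<and> conserved_quantity \<Sigma> \<A> d \<eta> p)"

definition baecklund_transform :: "'s set \<Rightarrow> 's chart set \<Rightarrow> nat \<Rightarrow> real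
    \<Rightarrow> ('s \<Rightarrow> ('p::finite, 'q::finite) ambient set) \<Rightarrow> ('s, 'p, 'q) end_form
    \<Rightarrow> ('s \<Rightarrow> nat \<Rightarrow> ('p, 'q) ambient)
    \<Rightarrow> ('s \<Rightarrow> ('p, 'q) ambient set) \<Rightarrow> ('s, 'p, 'q) end_form \<Rightarrow> bool" where
  "baecklund_transform \<Sigma> \<A> d \<mu> f \<eta> p g \<eta>' \<longleftrightarrow> darboux_transform \<Sigma> \<A> \<mu> f \<eta> g \<eta>'
     \<and> conserved_quantity \<Sigma> \<A> d \<eta> p
     \<and> (\<forall>x\<in>\<Sigma>. orthogonal_sets {poly_eval d (p x) \<mu>} (g x))"

text \<open>The conserved quantity that \<open>g\<close> inherits from that of \<open>f\<close>, away from the pole \<open>t = \<mu>\<close> of the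
  boost.\<close>

definition transformed_quantity :: "'s set \<Rightarrow> nat \<Rightarrow> real
    \<Rightarrow> ('s \<Rightarrow> ('p::finite, 'q::finite) ambient set) \<Rightarrow> ('s \<Rightarrow> ('p, 'q) ambient set)
    \<Rightarrow> ('s \<Rightarrow> nat \<Rightarrow> ('p, 'q) ambient) \<Rightarrow> ('s \<Rightarrow> nat \<Rightarrow> ('p, 'q) ambient) \<Rightarrow> bool" where
  "transformed_quantity \<Sigma> d \<mu> f g p p' \<longleftrightarrow> (\<forall>x\<in>\<Sigma>. \<forall>t. t \<noteq> \<mu> \<longrightarrow>
     poly_eval d (p' x) t = boost (f x) (g x) (1 - t / \<mu>) (poly_eval d (p x) t))"

text \<open>
  Permutability: \<open>fk\<close> is a simultaneous Darboux transform of \<open>fj\<close> and \<open>fl\<close>. The last condition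
  singles out the surface provided by the permutability theorem: the gauge transformation that
  carries the associated family of \<open>fi\<close> to that of \<open>fj\<close> carries the parallel line bundle \<open>fl\<close> to
  a parallel line bundle, and this is \<open>fk\<close>. For equal parameters this boost is singular.
\<close>

definition permutability :: "'s set \<Rightarrow> 's chart set \<Rightarrow> real \<Rightarrow> real
    \<Rightarrow> ('s \<Rightarrow> ('p::finite, 'q::finite) ambient set) \<Rightarrow> ('s, 'p, 'q) end_form
    \<Rightarrow> ('s \<Rightarrow> ('p, 'q) ambient set) \<Rightarrow> ('s, 'p, 'q) end_form
    \<Rightarrow> ('s \<Rightarrow> ('p, 'q) ambient set) \<Rightarrow> ('s, 'p, 'q) end_form
    \<Rightarrow> ('s \<Rightarrow> ('p, 'q) ambient set) \<Rightarrow> ('s, 'p, 'q) end_form \<Rightarrow> bool" where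
  "permutability \<Sigma> \<A> mij mil fi \<eta>i fj \<eta>j fl \<eta>l fk \<eta>k \<longleftrightarrow>
       darboux_transform \<Sigma> \<A> mij fi \<eta>i fj \<eta>j \<and> darboux_transform \<Sigma> \<A> mil fi \<eta>i fl \<eta>l
     \<and> darboux_transform \<Sigma> \<A> mil fj \<eta>j fk \<eta>k \<and> darboux_transform \<Sigma> \<A> mij fl \<eta>l fk \<eta>k
     \<and> mij \<noteq> mil
     \<and> (\<forall>x\<in>\<Sigma>. fk x = boost (fi x) (fj x) (1 - mil / mij) ` fl x)"

text \<open>
  Along the two axes the Baecklund transforms are taken with respect to the conserved quantity
  inherited from one and the same conserved quantity \<open>P 0 = Q 0\<close> of \<open>f 0 0\<close>.
\<close>

definition baecklund_lattice :: "'s set \<Rightarrow> 's chart set \<Rightarrow> nat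
    \<Rightarrow> (nat \<Rightarrow> nat \<Rightarrow> 's \<Rightarrow> ('p::finite, 'q::finite) ambient set) \<Rightarrow> bool" where
  "baecklund_lattice \<Sigma> \<A> d f \<longleftrightarrow>
     (\<exists>(\<eta> :: nat \<Rightarrow> nat \<Rightarrow> ('s, 'p, 'q) end_form) P Q \<mu> \<nu>. P 0 = Q 0
       \<and> (\<forall>m. baecklund_transform \<Sigma> \<A> d (\<mu> m) (f m 0) (\<eta> m 0) (P m) (f (Suc m) 0) (\<eta> (Suc m) 0)
              \<and> transformed_quantity \<Sigma> d (\<mu> m) (f m 0) (f (Suc m) 0) (P m) (P (Suc m)))
       \<and> (\<forall>n. baecklund_transform \<Sigma> \<A> d (\<nu> n) (f 0 n) (\<eta> 0 n) (Q n) (f 0 (Suc n)) (\<eta> 0 (Suc n))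
              \<and> transformed_quantity \<Sigma> d (\<nu> n) (f 0 n) (f 0 (Suc n)) (Q n) (Q (Suc n)))
       \<and> (\<forall>m n. permutability \<Sigma> \<A> (\<mu> m) (\<nu> n) (f m n) (\<eta> m n) (f (Suc m) n) (\<eta> (Suc m) n)
              (f m (Suc n)) (\<eta> m (Suc n)) (f (Suc m) (Suc n)) (\<eta> (Suc m) (Suc n))))"


section \<open>Discrete isothermic surfaces\<close>

text \<open>The domain is the quadrant of pairs of non-negative integers.\<close>

type_synonym vertex = "nat \<times> nat"

definition adjacent :: "vertex \<Rightarrow> vertex \<Rightarrow> bool" where
  "adjacent i j \<longleftrightarrow> j = i + (1, 0) \<or> j = i + (0, 1) \<or> i = j + (1, 0) \<or> i = j + (0, 1)"

definition discrete_surface :: "(vertex \<Rightarrow> ('p::finite, 'q::finite) ambient set) \<Rightarrow> bool" where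
  "discrete_surface F \<longleftrightarrow> (\<forall>i. F i \<in> null_lines)
     \<and> (\<forall>i j. adjacent i j \<longrightarrow> \<not> orthogonal_sets (F i) (F j))"

text \<open>Labels live on unoriented edges, that is, on sets of two adjacent vertices.\<close>

definition edge_labeling :: "(vertex set \<Rightarrow> real) \<Rightarrow> bool" where
  "edge_labeling lab \<longleftrightarrow> (\<forall>i j. adjacent i j \<longrightarrow> lab {i, j} \<noteq> 0)
     \<and> (\<forall>m n. lab {(m, n), (m + 1, n)} = lab {(m, n + 1), (m + 1, n + 1)}
            \<and> lab {(m, n), (m, n + 1)} = lab {(m + 1, n), (m + 1, n + 1)})"

definition discrete_connection :: "(vertex \<Rightarrow> ('p::finite, 'q::finite) ambient set)
    \<Rightarrow> (vertex set \<Rightarrow> real) \<Rightarrow> real \<Rightarrow> vertex \<Rightarrow> vertex \<Rightarrow> ('p, 'q) ambient \<Rightarrow> ('p, 'q) ambient" where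
  "discrete_connection F lab t j i = boost (F i) (F j) (1 - t / lab {i, j})"

text \<open>Flatness is required for all \<open>t\<close> at which the boosts are defined.\<close>

definition flat_discrete_connections ::
    "(vertex \<Rightarrow> ('p::finite, 'q::finite) ambient set) \<Rightarrow> (vertex set \<Rightarrow> real) \<Rightarrow> bool" where
  "flat_discrete_connections F lab \<longleftrightarrow> (\<forall>m n t.
     let i = (m, n); j = (m + 1, n); k = (m + 1, n + 1); l = (m, n + 1) in
       t \<noteq> lab {i, j} \<and> t \<noteq> lab {i, l} \<longrightarrow>
         discrete_connection F lab t k j \<circ> discrete_connection F lab t j i
       = discrete_connection F lab t k l \<circ> discrete_connection F lab t l i)"

definition discrete_isothermic_labeling ::
    "(vertex \<Rightarrow> ('p::finite, 'q::finite) ambient set) \<Rightarrow> (vertex set \<Rightarrow> real) \<Rightarrow> bool" where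
  "discrete_isothermic_labeling F lab \<longleftrightarrow>
     discrete_surface F \<and> edge_labeling lab \<and> flat_discrete_connections F lab"

definition discrete_isothermic :: "(vertex \<Rightarrow> ('p::finite, 'q::finite) ambient set) \<Rightarrow> bool" where
  "discrete_isothermic F \<longleftrightarrow> (\<exists>lab. discrete_isothermic_labeling F lab)"

definition discrete_conserved_quantity :: "nat \<Rightarrow> (vertex \<Rightarrow> ('p::finite, 'q::finite) ambient set)
    \<Rightarrow> (vertex set \<Rightarrow> real) \<Rightarrow> (vertex \<Rightarrow> nat \<Rightarrow> ('p, 'q) ambient) \<Rightarrow> bool" where
  "discrete_conserved_quantity d F lab P \<longleftrightarrow> (\<forall>i. P i d \<noteq> 0)
     \<and> (\<forall>i j t. adjacent i j \<and> t \<noteq> lab {i, j} \<longrightarrow>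
          discrete_connection F lab t j i (poly_eval d (P i) t) = poly_eval d (P j) t)"

definition discrete_special_isothermic ::
    "nat \<Rightarrow> (vertex \<Rightarrow> ('p::finite, 'q::finite) ambient set) \<Rightarrow> bool" where
  "discrete_special_isothermic d F \<longleftrightarrow>
     (\<exists>lab P. discrete_isothermic_labeling F lab \<and> discrete_conserved_quantity d F lab P)"

end

theory Submission
  imports Defs
begin

text \<open>
  Fix the point of the surface. Every vertex of the lattice then carries a null line and every edge a
  Lorentz boost depending on \<open>t\<close>, and permutability describes the fourth line of each square as the
  image of its neighbour under a boost. That the boosts around such a square compose consistently is
  an algebraic identity (\<open>boost_square\<close>), so the lattice parameters make the discrete map isothermic.

  A discrete conserved quantity is obtained by transporting the polynomial \<open>P(t)\<close> given at the initial
  vertex along the edges. A boost has a pole at the parameter of its edge and grows linearly in \<open>t\<close>.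
  The Baecklund condition removes the pole. The degree does not rise if the top coefficient is
  orthogonal to the null line of the initial vertex of the edge, and does not drop if the top
  coefficient does not lie in that line. Both properties of the top coefficient reproduce themselves at
  the other end of the edge (\<open>proper_top_transport\<close>), and the Baecklund condition reproduces itself
  across a square because boosts are isometries (\<open>perp_transport\<close>). So transport succeeds on the whole
  grid (\<open>discrete_special_isothermic_grid\<close>) once both properties hold at the initial vertex, that is,
  at the given point of the initial surface.

  There the smooth theory is needed, as the top coefficient \<open>W\<close> of a smooth conserved quantity is a
  priori only known not to vanish identically. In conformal curvature line coordinates closedness and
  the absence of umbilics force the isothermic form to be
  \<open>(k / E) \<psi> \<and> (\<psi>u du - \<psi>v dv)\<close> with \<open>k\<close> locally constant, \<open>E\<close> being the squared length of \<open>\<psi>u\<close>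
  (\<open>form_structure\<close>); on a connected surface it therefore vanishes nowhere. The form annihilates \<open>W\<close>,
  and the derivative of \<open>W\<close> is a value of the form. The first makes \<open>W\<close> orthogonal to the surface and
  its tangents. The second makes \<open>W\<close> parallel modulo the line of the surface, so if \<open>W\<close> lies in this
  line at one point it does so nearby, where \<open>W = g \<psi>\<close>; as the form is trace-free, this is
  only possible with \<open>g = 0\<close> (\<open>annihilated_section_vanishes\<close>). By connectedness \<open>W\<close> would vanish
  identically, contrary to the degree being \<open>d\<close> (\<open>top_coefficient_proper\<close>).
\<close>

section \<open>Lorentz boosts and Bianchi permutability\<close>

lemma pmetric_add_right: "pmetric v (u + w) = pmetric v u + pmetric v w"
  and pmetric_diff_right: "pmetric v (u - w) = pmetric v u - pmetric v w"
  and pmetric_minus_left: "pmetric (- v) w = - pmetric v w"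
  and pmetric_minus_right: "pmetric v (- w) = - pmetric v w"
  and pmetric_zero_left [simp]: "pmetric 0 w = 0"
  and pmetric_zero_right [simp]: "pmetric v 0 = 0"
  by (simp_all add: pmetric_def inner_simps)

lemmas pmetric_linear = pmetric_add_left pmetric_add_right pmetric_diff_left pmetric_diff_right
  pmetric_minus_left pmetric_minus_right pmetric_scaleR_left pmetric_scaleR_right

lemma orthogonal_span_spans: "orthogonal_sets (span {u}) (span {v}) \<longleftrightarrow> pmetric u v = 0"
  by (auto simp: orthogonal_sets_def span_singleton pmetric_linear)

lemma boost_apply:
  assumes "pmetric a a = 0" "pmetric b b = 0" "pmetric a b \<noteq> 0"
  shows "boost (span {a}) (span {b}) s v = v + ((inverse s - 1) * pmetric v b / pmetric a b) *\<^sub>R a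
           + ((s - 1) * pmetric v a / pmetric a b) *\<^sub>R b"
  by (simp add: boost_span[OF assms])

lemma boost_isometry:
  assumes "pmetric a a = 0" "pmetric b b = 0" "pmetric a b \<noteq> 0" "s \<noteq> 0"
  shows "pmetric (boost (span {a}) (span {b}) s v) (boost (span {a}) (span {b}) s w) = pmetric v w"
  using assms unfolding boost_apply[OF assms(1-3)]
  by (simp add: pmetric_linear pmetric_commute[of b a] pmetric_commute[of a w]
      pmetric_commute[of b w]) (simp add: field_simps)

lemma boost_reverse:
  assumes "pmetric a a = 0" "pmetric b b = 0" "pmetric a b \<noteq> 0" "s \<noteq> 0"
  shows "boost (span {b}) (span {a}) s (boost (span {a}) (span {b}) s v) = v"
proof -
  have "pmetric b a \<noteq> 0" using assms by (simp add: pmetric_commute)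
  note * = boost_apply[OF assms(1-3)] boost_apply[OF assms(2,1) this]
  let ?w = "boost (span {a}) (span {b}) s v"
  have "pmetric ?w a = s * pmetric v a" "pmetric ?w b = inverse s * pmetric v b"
    using assms by (simp_all add: *(1) pmetric_linear pmetric_commute[of b a] field_simps)
  then have "boost (span {b}) (span {a}) s ?w = v
    + ((inverse s - 1) * pmetric v b / pmetric a b + (s - 1) * (inverse s * pmetric v b) / pmetric a b) *\<^sub>R a
    + ((s - 1) * pmetric v a / pmetric a b + (inverse s - 1) * (s * pmetric v a) / pmetric a b) *\<^sub>R b"
    by (simp only: *(2)[of _ ?w] pmetric_commute[of b a] scaleR_add_left) (simp add: *(1))
  also have "\<dots> = v" using assms by (simp add: field_simps)
  finally show ?thesis .
qed

text \<open>
  Bianchi permutability. For boosts that belong to parameters \<open>\<mu>\<close> and \<open>\<nu>\<close> the relevant values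
  are \<open>s = 1 - \<nu> / \<mu>\<close>, \<open>\<sigma> = 1 - t / \<nu>\<close> and \<open>\<tau> = 1 - t / \<mu>\<close>, and \<open>param\<close> is the relation between
  them that no longer mentions \<open>\<mu>\<close>, \<open>\<nu>\<close> and \<open>t\<close>. Both sides differ from \<open>v\<close> by a combination of
  \<open>a\<close>, \<open>b\<close> and \<open>c\<close>. The two boosts on either side contribute opposite amounts in the direction
  of \<open>a\<close>, so that coefficient vanishes on both sides; the other two are compared as rational
  functions.
\<close>
lemma boost_square:
  fixes a b c k v :: "('p::finite, 'q::finite) ambient" and s \<sigma> \<tau> :: real
  assumes null: "pmetric a a = 0" "pmetric b b = 0" "pmetric c c = 0"
    and ab: "pmetric a b \<noteq> 0" and ac: "pmetric a c \<noteq> 0" and bc: "pmetric b c \<noteq> 0"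
    and s: "s \<noteq> 0" "s \<noteq> 1" and \<sigma>: "\<sigma> \<noteq> 0" and \<tau>: "\<tau> \<noteq> 0"
    and param: "1 - \<tau> = (1 - s) * (1 - \<sigma>)"
    and k: "k = boost (span {a}) (span {b}) s c"
  shows "boost (span {b}) (span {k}) \<sigma> (boost (span {a}) (span {b}) \<tau> v)
       = boost (span {c}) (span {k}) \<tau> (boost (span {a}) (span {c}) \<sigma> v)"
proof -
  define A B C where "A = pmetric a b" and "B = pmetric a c" and "C = pmetric b c"
  define x y z where "x = pmetric v a" and "y = pmetric v b" and "z = pmetric v c"
  note ABC = A_def[symmetric] B_def[symmetric] C_def[symmetric]
    x_def[symmetric] y_def[symmetric] z_def[symmetric]
  have nz: "A \<noteq> 0" "B \<noteq> 0" "C \<noteq> 0" using ab ac bc by (simp_all add: ABC)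
  define k1 k2 where "k1 = (inverse s - 1) * C / A" and "k2 = (s - 1) * B / A"
  have k': "k = c + k1 *\<^sub>R a + k2 *\<^sub>R b"
    unfolding k k1_def k2_def boost_apply[OF null(1,2) ab] by (simp add: pmetric_commute[of c b] pmetric_commute[of c a] ABC)
  have kk: "pmetric k k = 0"
    using boost_isometry[OF null(1,2) ab s(1), of c c] by (simp add: k null)
  have bk: "pmetric b k = C / s"
    using nz s unfolding k' k1_def k2_def
    by (simp add: pmetric_linear null pmetric_commute[of b a] ABC field_simps)
  have ck: "pmetric c k = B * C * (1 - s)^2 / (A * s)"
    using nz s unfolding k' k1_def k2_def
    by (simp add: pmetric_linear null pmetric_commute[of c b] pmetric_commute[of c a] ABC)
      (simp add: field_simps power2_eq_square)
  have bk0: "pmetric b k \<noteq> 0" and ck0: "pmetric c k \<noteq> 0"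
    using nz s by (simp_all add: bk ck)
  have vk: "pmetric u k = pmetric u c + k1 * pmetric u a + k2 * pmetric u b" for u
    by (simp add: k' pmetric_linear)
  define w where "w = boost (span {a}) (span {b}) \<tau> v"
  have w: "w = v + ((inverse \<tau> - 1) * y / A) *\<^sub>R a + ((\<tau> - 1) * x / A) *\<^sub>R b"
    by (simp add: w_def boost_apply[OF null(1,2) ab] ABC)
  have wb: "pmetric w b = y / \<tau>" and wa: "pmetric w a = \<tau> * x"
    and wc: "pmetric w c = z + (inverse \<tau> - 1) * y * B / A + (\<tau> - 1) * x * C / A"
    using nz \<tau> by (simp_all add: w pmetric_linear null pmetric_commute[of b a] ABC field_simps)
  define w' where "w' = boost (span {a}) (span {c}) \<sigma> v"
  have w': "w' = v + ((inverse \<sigma> - 1) * z / B) *\<^sub>R a + ((\<sigma> - 1) * x / B) *\<^sub>R c"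
    by (simp add: w'_def boost_apply[OF null(1,3) ac] ABC)
  have wc': "pmetric w' c = z / \<sigma>" and wa': "pmetric w' a = \<sigma> * x"
    and wb': "pmetric w' b = y + (inverse \<sigma> - 1) * z * A / B + (\<sigma> - 1) * x * C / B"
    using nz \<sigma> by (simp_all add: w' pmetric_linear null pmetric_commute[of c b] pmetric_commute[of c a]
       pmetric_commute[of b a] ABC field_simps)
  define p q where "p = (\<sigma> - 1) * (y / \<tau>) / (C / s)"
    and "q = (inverse \<sigma> - 1) * pmetric w k / (C / s)"
  define p' q' where "p' = (\<tau> - 1) * (z / \<sigma>) / (B * C * (1 - s)^2 / (A * s))"
    and "q' = (inverse \<tau> - 1) * pmetric w' k / (B * C * (1 - s)^2 / (A * s))"
  have L: "boost (span {b}) (span {k}) \<sigma> w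
    = v + ((inverse \<tau> - 1) * y / A + p * k1) *\<^sub>R a + ((\<tau> - 1) * x / A + q + p * k2) *\<^sub>R b + p *\<^sub>R c"
    unfolding boost_apply[OF null(2) kk bk0] wb bk p_def[symmetric] q_def[symmetric]
    unfolding w k' by (simp add: scaleR_add_left scaleR_add_right)
  have R: "boost (span {c}) (span {k}) \<tau> w'
    = v + ((inverse \<sigma> - 1) * z / B + p' * k1) *\<^sub>R a + (p' * k2) *\<^sub>R b + ((\<sigma> - 1) * x / B + q' + p') *\<^sub>R c"
    unfolding boost_apply[OF null(3) kk ck0] wc' ck p'_def[symmetric] q'_def[symmetric]
    unfolding w' k' by (simp add: scaleR_add_left scaleR_add_right)
  \<comment> \<open>With \<open>r\<close> and \<open>\<sigma>\<close> as independent parameters the coefficients become rational identities.\<close>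
  define r where "r = 1 - s"
  have r: "s = 1 - r" "r \<noteq> 0" "1 - r \<noteq> 0" using s by (auto simp: r_def)
  have \<tau>': "\<tau> = 1 - r * (1 - \<sigma>)" using param by (simp add: r_def)
  have ca: "(inverse \<tau> - 1) * y / A + p * k1 = 0" "(inverse \<sigma> - 1) * z / B + p' * k1 = 0"
  proof -
    show "(inverse \<tau> - 1) * y / A + p * k1 = 0"
      unfolding p_def k1_def r(1) using nz \<sigma> \<tau> r(2,3)
      by (simp add: divide_simps) (simp add: \<tau>' algebra_simps)
    show "(inverse \<sigma> - 1) * z / B + p' * k1 = 0"
      unfolding p'_def k1_def r(1) using nz \<sigma> \<tau> r(2,3)
      by (simp add: divide_simps) (simp add: \<tau>' algebra_simps power2_eq_square)
  qed
  have cb: "(\<tau> - 1) * x / A + q + p * k2 = p' * k2"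
    unfolding p_def q_def p'_def k2_def vk wa wb wc k1_def r(1) using nz \<sigma> \<tau> r(2,3)
    by (simp add: divide_simps) (simp add: \<tau>', algebra)
  have cc: "(\<sigma> - 1) * x / B + q' + p' = p"
    unfolding p_def q'_def p'_def vk wa' wb' wc' k1_def k2_def r(1) using nz \<sigma> \<tau> r(2,3)
    by (simp add: divide_simps) (simp add: \<tau>', algebra)
  show ?thesis
    unfolding w_def[symmetric] w'_def[symmetric] L R ca cb cc by simp
qed

lemma linear_boost:
  assumes "pmetric a a = 0" "pmetric b b = 0" "pmetric a b \<noteq> 0"
  shows "linear (boost (span {a}) (span {b}) s)"
  unfolding boost_span[OF assms]
  by (rule linearI)
    (simp_all add: pmetric_linear algebra_simps add_divide_distrib diff_divide_distrib)

lemma boost_upper: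
  assumes "pmetric a a = 0" "pmetric b b = 0" "pmetric a b \<noteq> 0"
  shows "boost (span {a}) (span {b}) s b = s *\<^sub>R b"
  unfolding boost_apply[OF assms] using assms
  by (simp add: pmetric_commute[of b a] scaleR_left_diff_distrib)

section \<open>Polynomials transported along an edge\<close>

text \<open>
  A boost is undefined at one parameter value. Identities between polynomials that are proved for
  the remaining values extend to it by continuity.
\<close>
lemma eq_at_exceptional_point:
  fixes f g :: "real \<Rightarrow> 'a::t2_space"
  assumes "isCont f c" "isCont g c" and eq: "eventually (\<lambda>t. f t = g t) (at c)"
  shows "f c = g c"
proof -
  have "(g \<longlongrightarrow> f c) (at c)"
    using assms(1) eq unfolding isCont_def by (simp cong: tendsto_cong)
  then show ?thesis
    using assms(2) unfolding isCont_def by (metis tendsto_unique at_neq_bot)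
qed

lemma isCont_poly_eval: "isCont (poly_eval d p) c" for p :: "nat \<Rightarrow> 'v::real_normed_vector"
  unfolding poly_eval_def by (intro continuous_intros)

lemma poly_eval_unique:
  fixes p q :: "nat \<Rightarrow> 'v::euclidean_space"
  assumes eq: "\<And>t. t \<noteq> c \<Longrightarrow> poly_eval d p t = poly_eval d q t" and k: "k \<le> d"
  shows "p k = q k"
proof -
  have all: "poly_eval d p t = poly_eval d q t" for t
  proof (cases "t = c")
    case True
    show ?thesis unfolding True
      by (rule eq_at_exceptional_point[OF isCont_poly_eval isCont_poly_eval])
        (rule eventually_mono[OF eventually_neq_at_within[of c c] eq])
  qed (rule eq)
  show ?thesis
  proof (rule euclidean_eqI)
    fix b :: 'v
    have "\<forall>t. (\<Sum>k\<le>d. (p k \<bullet> b) * t ^ k) = (\<Sum>k\<le>d. (q k \<bullet> b) * t ^ k)"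
    proof
      fix t :: real
      have "poly_eval d p t \<bullet> b = poly_eval d q t \<bullet> b" by (simp add: all)
      then show "(\<Sum>k\<le>d. (p k \<bullet> b) * t ^ k) = (\<Sum>k\<le>d. (q k \<bullet> b) * t ^ k)"
        by (simp add: poly_eval_def inner_sum_left mult.commute)
    qed
    then show "p k \<bullet> b = q k \<bullet> b"
      using k by (simp only: polyfun_eq_coeffs)
  qed
qed

lemma pmetric_poly_eval: "pmetric (poly_eval d p t) w = poly_eval d (\<lambda>k. pmetric (p k) w) t"
proof -
  have "pmetric (sum g A) w = (\<Sum>k\<in>A. pmetric (g k) w)" for g and A :: "nat set"
    by (induction A rule: infinite_finite_induct) (simp_all add: pmetric_linear)
  then show ?thesis by (simp add: poly_eval_def pmetric_linear)
qed

text \<open>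
  The value \<open>t = \<mu>\<close> is left out because the boost with factor 0 does not exist.
\<close>
definition edge_property where
  "edge_property d \<mu> A B p p' \<longleftrightarrow>
     (\<forall>t. t \<noteq> \<mu> \<longrightarrow> poly_eval d p' t = boost A B (1 - t / \<mu>) (poly_eval d p t))"

lemma edge_property_reverse:
  assumes "pmetric a a = 0" "pmetric b b = 0" "pmetric a b \<noteq> 0" "\<mu> \<noteq> 0"
    and "edge_property d \<mu> (span {a}) (span {b}) p p'"
  shows "edge_property d \<mu> (span {b}) (span {a}) p' p"
  using assms by (auto simp: edge_property_def boost_reverse)

text \<open>
  Transporting a polynomial \<open>P\<close> by the boost with factor \<open>1 - t / \<mu>\<close> adds to it
  a multiple of \<open>a\<close> with a pole at \<open>t = \<mu>\<close>, whose residue is proportional to the product of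
  \<open>P(\<mu>)\<close> with \<open>b\<close>, and a multiple of \<open>b\<close> proportional to \<open>t\<close> times the product of \<open>P(t)\<close> with \<open>a\<close>. So
  \<open>perp\<close> removes the pole and \<open>top\<close> keeps the degree from rising. As the boost multiplies the
  product with \<open>b\<close> by \<open>1 / (1 - t / \<mu>)\<close>, the same division by a linear factor that removes the pole
  lowers the degree of that product, which makes the new top coefficient orthogonal to \<open>b\<close>.
\<close>
lemma edge_transport_exists:
  fixes a b :: "('p::finite, 'q::finite) ambient"
  assumes a: "pmetric a a = 0" and b: "pmetric b b = 0" and ab: "pmetric a b \<noteq> 0" and \<mu>: "\<mu> \<noteq> 0"
    and top: "pmetric (p d) a = 0" and perp: "pmetric (poly_eval d p \<mu>) b = 0"
  obtains p' x y where "edge_property d \<mu> (span {a}) (span {b}) p p'"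
    and "pmetric (p' d) b = 0" and "p' d = p d - x *\<^sub>R a - y *\<^sub>R b"
proof -
  obtain r where r: "\<And>z. (\<Sum>i\<le>d. pmetric (p i) b * z ^ i) = (z - \<mu>) * (\<Sum>i<d. r i * z ^ i)"
  proof (rule polyfun_linear_factor_root[of "\<lambda>i. pmetric (p i) b" \<mu> d, THEN exE])
    show "(\<Sum>i\<le>d. pmetric (p i) b * \<mu> ^ i) = 0"
      using perp unfolding pmetric_poly_eval by (simp add: poly_eval_def mult.commute)
  qed blast
  \<comment> \<open>Coefficients of the two corrections, which are \<open>t\<close> times polynomials of degree below \<open>d\<close>.\<close>
  define g h where "g k = r k / pmetric a b" and "h k = pmetric (p k) a / (\<mu> * pmetric a b)" for k
  define p' where "p' k = (case k of 0 \<Rightarrow> p 0 | Suc j \<Rightarrow> p (Suc j) - g j *\<^sub>R a - h j *\<^sub>R b)" for k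
  have eval: "poly_eval d p' t = poly_eval d p t - (t * (\<Sum>i<d. g i * t ^ i)) *\<^sub>R a
      - (t * (\<Sum>i<d. h i * t ^ i)) *\<^sub>R b" for t
    unfolding poly_eval_def sum.atMost_shift p'_def
    by (simp add: scaleR_diff_right sum_subtractf sum_distrib_left scaleR_sum_left mult_ac)
  have pb: "pmetric (poly_eval d p t) b = (t - \<mu>) * (\<Sum>i<d. r i * t ^ i)" for t
    unfolding pmetric_poly_eval r[symmetric] by (simp add: poly_eval_def mult.commute)
  have pa: "pmetric (poly_eval d p t) a = (\<Sum>i<d. pmetric (p i) a * t ^ i)" for t
    unfolding pmetric_poly_eval
    by (simp add: poly_eval_def mult.commute lessThan_Suc_atMost[symmetric] top)
  have edge: "edge_property d \<mu> (span {a}) (span {b}) p p'"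
    unfolding edge_property_def
  proof (intro allI impI)
    fix t :: real assume t: "t \<noteq> \<mu>"
    have "(inverse (1 - t / \<mu>) - 1) * pmetric (poly_eval d p t) b / pmetric a b
        = - (t * (\<Sum>i<d. g i * t ^ i))"
      unfolding pb g_def using t \<mu> ab
      by (simp add: sum_divide_distrib[symmetric]) (simp add: field_simps)
    moreover have "(1 - t / \<mu> - 1) * pmetric (poly_eval d p t) a / pmetric a b
        = - (t * (\<Sum>i<d. h i * t ^ i))"
      unfolding pa h_def using \<mu> ab by (simp add: sum_divide_distrib[symmetric])
    ultimately show "poly_eval d p' t = boost (span {a}) (span {b}) (1 - t / \<mu>) (poly_eval d p t)"
      unfolding eval boost_apply[OF a b ab] by simp
  qed
  have "poly_eval d (\<lambda>k. pmetric (p' k) b) t = poly_eval d (\<lambda>k. if k < d then - \<mu> * r k else 0) t"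
    if t: "t \<noteq> \<mu>" for t
  proof -
    have "poly_eval d (\<lambda>k. pmetric (p' k) b) t
        = pmetric (poly_eval d p t) b - (t * (\<Sum>i<d. g i * t ^ i)) * pmetric a b"
      unfolding pmetric_poly_eval[symmetric] eval by (simp add: pmetric_linear b)
    also have "\<dots> = - \<mu> * (\<Sum>i<d. r i * t ^ i)"
      unfolding pb g_def using ab by (simp add: sum_divide_distrib[symmetric] algebra_simps)
    also have "\<dots> = poly_eval d (\<lambda>k. if k < d then - \<mu> * r k else 0) t"
      by (simp add: poly_eval_def lessThan_Suc_atMost[symmetric] sum_distrib_left mult_ac)
    finally show ?thesis .
  qed
  from poly_eval_unique[where c = \<mu> and k = d, OF this] have "pmetric (p' d) b = 0" by simp
  moreover have "\<exists>x y. p' d = p d - x *\<^sub>R a - y *\<^sub>R b"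
  proof (cases d)
    case 0
    then have "p' d = p d - 0 *\<^sub>R a - 0 *\<^sub>R b" by (simp add: p'_def)
    then show ?thesis by blast
  qed (auto simp: p'_def)
  ultimately show thesis using that edge by blast
qed

lemma edge_property_unique:
  fixes p' q' :: "nat \<Rightarrow> ('p::finite, 'q::finite) ambient"
  assumes "edge_property d \<mu> A B p p'" "edge_property d \<mu> A B p q'" "k \<le> d"
  shows "p' k = q' k"
  by (rule poly_eval_unique[where c = \<mu> and d = d]) (use assms in \<open>auto simp: edge_property_def\<close>)

text \<open>
  The two halves serve opposite purposes: orthogonality of the top coefficient to the line keeps the
  degree from rising under a boost, and the top coefficient not lying in the line keeps it from
  dropping. Only together do they pass from one end of an edge to the other.
\<close>
definition proper_top where
  "proper_top d p a \<longleftrightarrow> pmetric (p d) a = 0 \<and> p d \<notin> span {a}"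

text \<open>
  The top coefficients at the two ends differ by a combination of \<open>a\<close> and \<open>b\<close>. If the new one were
  a multiple of \<open>b\<close>, the old one would lie in the plane of \<open>a\<close> and \<open>b\<close>, and being orthogonal to \<open>a\<close>
  it would be a multiple of \<open>a\<close>.
\<close>
lemma proper_top_transport:
  fixes a b :: "('p::finite, 'q::finite) ambient"
  assumes "pmetric a a = 0" "pmetric b b = 0" and ab: "pmetric a b \<noteq> 0" and "\<mu> \<noteq> 0"
    and "proper_top d p a" and "pmetric (poly_eval d p \<mu>) b = 0"
    and edge: "edge_property d \<mu> (span {a}) (span {b}) p p'"
  shows "proper_top d p' b"
proof -
  have top: "pmetric (p d) a = 0" "p d \<notin> span {a}"
    using assms(5) by (simp_all add: proper_top_def)
  obtain q x y where q: "edge_property d \<mu> (span {a}) (span {b}) p q" "pmetric (q d) b = 0"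
      "q d = p d - x *\<^sub>R a - y *\<^sub>R b"
    using edge_transport_exists[of a b \<mu> p d] assms top by blast
  have eq: "p' d = q d" using edge_property_unique[OF edge q(1)] by simp
  have "p' d \<notin> span {b}"
  proof
    assume "p' d \<in> span {b}"
    then obtain z' where "p' d = z' *\<^sub>R b" by (auto simp: span_singleton)
    then have "p d = x *\<^sub>R a + (z' + y) *\<^sub>R b"
      using q(3) by (simp add: eq scaleR_add_left diff_eq_eq add_ac)
    then obtain z where z: "p d = x *\<^sub>R a + z *\<^sub>R b" ..
    then have "z = 0" using top(1) ab assms(1) by (simp add: pmetric_linear pmetric_commute[of b a])
    then show False using z top(2) by (auto simp: span_singleton)
  qed
  then show ?thesis using q(2) by (simp add: proper_top_def eq)
qed

section \<open>Elementary quadrilaterals and the grid\<close>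

text \<open>
  An elementary quadrilateral, with the edge \<open>a b\<close> carrying \<open>\<mu>\<close>, the edge \<open>a c\<close> carrying \<open>\<nu>\<close> and
  \<open>k\<close> the vertex opposite to \<open>a\<close>.
\<close>
locale bianchi_square =
  fixes a b c k :: "('p::finite, 'q::finite) ambient" and \<mu> \<nu> :: real
  assumes null: "pmetric a a = 0" "pmetric b b = 0" "pmetric c c = 0" "pmetric k k = 0"
    and ab: "pmetric a b \<noteq> 0" and ac: "pmetric a c \<noteq> 0"
    and bk: "pmetric b k \<noteq> 0" and ck: "pmetric c k \<noteq> 0"
    and params: "\<mu> \<noteq> 0" "\<nu> \<noteq> 0" "\<mu> \<noteq> \<nu>"
    and fourth: "span {k} = boost (span {a}) (span {b}) (1 - \<nu> / \<mu>) ` span {c}"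
begin

lemma fourth_line: "span {k} = span {boost (span {a}) (span {b}) (1 - \<nu> / \<mu>) c}"
  using linear_span_image[OF linear_boost[OF null(1,2) ab], of _ "{c}"]
  by (simp only: fourth image_insert image_empty)

lemma factor_nonzero: "1 - \<nu> / \<mu> \<noteq> 0"
  using params by simp

lemma fourth_multiple:
  obtains r where "k = r *\<^sub>R boost (span {a}) (span {b}) (1 - \<nu> / \<mu>) c"
proof -
  have "k \<in> span {boost (span {a}) (span {b}) (1 - \<nu> / \<mu>) c}"
    unfolding fourth_line[symmetric] by (simp add: span_base)
  then show thesis using that by (auto simp: span_singleton)
qed

text \<open>
  The boost preserves the line of \<open>b\<close> and takes that of \<open>c\<close> to that of \<open>k\<close>, so \<open>b\<close> and \<open>c\<close> are
  non-orthogonal because \<open>b\<close> and \<open>k\<close> are.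
\<close>
lemma bc: "pmetric b c \<noteq> 0"
proof
  assume 0: "pmetric b c = 0"
  obtain r where r: "k = r *\<^sub>R boost (span {a}) (span {b}) (1 - \<nu> / \<mu>) c"
    by (rule fourth_multiple)
  have "(1 - \<nu> / \<mu>) * pmetric b (boost (span {a}) (span {b}) (1 - \<nu> / \<mu>) c) = pmetric b c"
    using boost_isometry[OF null(1,2) ab factor_nonzero, of b c]
    by (simp add: boost_upper[OF null(1,2) ab] pmetric_linear)
  then show False using 0 factor_nonzero bk by (simp add: r pmetric_linear)
qed

lemma flat:
  assumes "t \<noteq> \<mu>" "t \<noteq> \<nu>"
  shows "boost (span {b}) (span {k}) (1 - t / \<nu>) (boost (span {a}) (span {b}) (1 - t / \<mu>) v)
       = boost (span {c}) (span {k}) (1 - t / \<mu>) (boost (span {a}) (span {c}) (1 - t / \<nu>) v)"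
  unfolding fourth_line
  by (rule boost_square[OF null(1-3) ab ac bc _ _ _ _ _ refl]) (use assms params in auto)

text \<open>
  The orthogonality that makes transport along \<open>a c\<close> possible is inherited by the opposite edge
  \<open>b k\<close>: at \<open>t = \<nu>\<close> the boost along \<open>a b\<close> is an isometry that carries the polynomial at \<open>a\<close> to the
  one at \<open>b\<close> and the line of \<open>c\<close> to that of \<open>k\<close>.
\<close>
lemma perp_transport:
  assumes "edge_property d \<mu> (span {a}) (span {b}) p pb" and "pmetric (poly_eval d p \<nu>) c = 0"
  shows "pmetric (poly_eval d pb \<nu>) k = 0"
proof -
  obtain r where r: "k = r *\<^sub>R boost (span {a}) (span {b}) (1 - \<nu> / \<mu>) c"
    by (rule fourth_multiple)
  have "poly_eval d pb \<nu> = boost (span {a}) (span {b}) (1 - \<nu> / \<mu>) (poly_eval d p \<nu>)"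
    using assms(1) params(3) by (simp add: edge_property_def)
  then show ?thesis
    using assms(2) by (simp add: r pmetric_linear boost_isometry[OF null(1,2) ab factor_nonzero])
qed

text \<open>
  Flatness gives the fourth edge for all parameters at which all four boosts exist. On the edge
  \<open>c k\<close> the value \<open>t = \<nu>\<close> is also required, although the boosts along \<open>a c\<close> and \<open>b k\<close> are undefined
  there; continuity supplies it.
\<close>
lemma edge_property_opposite:
  assumes pb: "edge_property d \<mu> (span {a}) (span {b}) p pb"
    and pc: "edge_property d \<nu> (span {a}) (span {c}) p pc"
    and pk: "edge_property d \<nu> (span {b}) (span {k}) pb pk"
  shows "edge_property d \<mu> (span {c}) (span {k}) pc pk"
proof -
  let ?R = "\<lambda>t. boost (span {c}) (span {k}) (1 - t / \<mu>) (poly_eval d pc t)"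
  have generic: "poly_eval d pk t = ?R t" if "t \<noteq> \<mu>" "t \<noteq> \<nu>" for t
    using that pb pc pk flat[OF that] by (simp add: edge_property_def)
  have "poly_eval d pk \<nu> = ?R \<nu>"
  proof (rule eq_at_exceptional_point[OF isCont_poly_eval])
    have "isCont (\<lambda>t. pmetric (poly_eval d pc t) w) \<nu>" for w
      unfolding pmetric_poly_eval by (rule isCont_poly_eval)
    then show "isCont ?R \<nu>"
      unfolding boost_apply[OF null(3,4) ck] using ck params
      by (intro continuous_intros isCont_poly_eval) auto
    show "eventually (\<lambda>t. poly_eval d pk t = ?R t) (at \<nu>)"
      using eventually_neq_at_within[of \<mu> \<nu>] eventually_neq_at_within[of \<nu> \<nu>]
      by eventually_elim (rule generic)
  qed
  with generic show ?thesis by (auto simp: edge_property_def)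
qed

end

text \<open>
  An edge is horizontal precisely when its two vertices share the second coordinate, and the smaller
  coordinate in its direction then tells which step of the axis it repeats.
\<close>
definition grid_label :: "(nat \<Rightarrow> real) \<Rightarrow> (nat \<Rightarrow> real) \<Rightarrow> vertex set \<Rightarrow> real" where
  "grid_label \<mu> \<nu> e = (if card (snd ` e) = 1 then \<mu> (Min (fst ` e)) else \<nu> (Min (snd ` e)))"

lemma grid_label_edges:
  "grid_label \<mu> \<nu> {(m, n), (Suc m, n)} = \<mu> m" "grid_label \<mu> \<nu> {(m, n), (m, Suc n)} = \<nu> n"
  "grid_label \<mu> \<nu> {(Suc m, n), (m, n)} = \<mu> m" "grid_label \<mu> \<nu> {(m, Suc n), (m, n)} = \<nu> n"
  by (simp_all add: grid_label_def)

lemma adjacent_cases: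
  assumes "adjacent i j"
  obtains m n where "i = (m, n)" "j = (Suc m, n)" | m n where "i = (m, n)" "j = (m, Suc n)"
    | m n where "i = (Suc m, n)" "j = (m, n)" | m n where "i = (m, Suc n)" "j = (m, n)"
  using assms unfolding adjacent_def by (cases i; cases j) auto

text \<open>
  The quantities along the horizontal axis are transported upwards, row by row. In each row the
  polynomials have a proper top coefficient, are orthogonal to the next row at the parameter of the
  coming step, and satisfy the edge property horizontally; each of these passes to the next row
  through the squares in between. On the vertical axis transport reproduces the quantities given
  there, which supplies the orthogonality needed at the left end of every row.
\<close>
lemma discrete_special_isothermic_grid:
  fixes u :: "nat \<Rightarrow> nat \<Rightarrow> ('p::finite, 'q::finite) ambient"
  assumes u: "\<And>m n. u m n \<in> light_cone"
    and H: "\<And>m n. pmetric (u m n) (u (Suc m) n) \<noteq> 0"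
    and V: "\<And>m n. pmetric (u m n) (u m (Suc n)) \<noteq> 0"
    and labels: "\<And>m. \<mu> m \<noteq> 0" "\<And>n. \<nu> n \<noteq> 0" "\<And>m n. \<mu> m \<noteq> \<nu> n"
    and fourth: "\<And>m n. span {u (Suc m) (Suc n)}
      = boost (span {u m n}) (span {u (Suc m) n}) (1 - \<nu> n / \<mu> m) ` span {u m (Suc n)}"
    and P: "\<And>m. edge_property d (\<mu> m) (span {u m 0}) (span {u (Suc m) 0}) (P m) (P (Suc m))"
      "\<And>m. pmetric (poly_eval d (P m) (\<mu> m)) (u (Suc m) 0) = 0"
    and Q: "\<And>n. edge_property d (\<nu> n) (span {u 0 n}) (span {u 0 (Suc n)}) (Q n) (Q (Suc n))"
      "\<And>n. pmetric (poly_eval d (Q n) (\<nu> n)) (u 0 (Suc n)) = 0"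
    and PQ: "P 0 = Q 0" and top: "proper_top d (P 0) (u 0 0)"
  shows "discrete_special_isothermic d (\<lambda>(m, n). span {u m n})"
proof -
  have null: "pmetric (u m n) (u m n) = 0" and nz: "u m n \<noteq> 0" for m n
    using u by (auto simp: light_cone_def)
  have sq: "bianchi_square (u m n) (u (Suc m) n) (u m (Suc n)) (u (Suc m) (Suc n)) (\<mu> m) (\<nu> n)"
    for m n
    by unfold_locales (use null nz H V labels fourth in auto)
  let ?H = "\<lambda>m n. edge_property d (\<mu> m) (span {u m n}) (span {u (Suc m) n})"
  let ?V = "\<lambda>m n. edge_property d (\<nu> n) (span {u m n}) (span {u m (Suc n)})"
  \<comment> \<open>The first argument of \<open>G\<close> is the row: the recursion starts from the horizontal axis.\<close>
  define G where "G = rec_nat P (\<lambda>n row m. SOME p'. ?V m n (row m) p')"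
  have G0: "G 0 m = P m" and GSuc: "G (Suc n) m = (SOME p'. ?V m n (G n m) p')" for m n
    by (simp_all add: G_def)
  have Vstep: "?V m n (G n m) (G (Suc n) m)"
    if "proper_top d (G n m) (u m n)" "pmetric (poly_eval d (G n m) (\<nu> n)) (u m (Suc n)) = 0" for m n
  proof -
    have "pmetric (G n m d) (u m n) = 0" using that(1) by (simp add: proper_top_def)
    from edge_transport_exists[where p = "G n m", OF null null V labels(2) this that(2)]
    have "\<exists>p'. ?V m n (G n m) p'" by blast
    then show ?thesis unfolding GSuc by (rule someI_ex)
  qed
  have main: "(\<forall>m. proper_top d (G n m) (u m n)
      \<and> pmetric (poly_eval d (G n m) (\<nu> n)) (u m (Suc n)) = 0 \<and> ?H m n (G n m) (G n (Suc m)))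
      \<and> (\<forall>k\<le>d. G n 0 k = Q n k)" for n
  proof (induction n)
    case 0
    have top: "proper_top d (P m) (u m 0)" for m
    proof (induction m)
      case (Suc m)
      show ?case
        using proper_top_transport[OF null null H labels(1) Suc P(2) P(1)] .
    qed (rule top)
    have perp: "pmetric (poly_eval d (P m) (\<nu> 0)) (u m (Suc 0)) = 0" for m
    proof (induction m)
      case 0 show ?case using Q(2)[of 0] PQ by simp
    next
      case (Suc m)
      show ?case using bianchi_square.perp_transport[OF sq P(1) Suc] .
    qed
    show ?case using top perp P(1) by (simp add: G0 PQ)
  next
    case (Suc n)
    then have IH: "\<And>m. proper_top d (G n m) (u m n)"
        "\<And>m. pmetric (poly_eval d (G n m) (\<nu> n)) (u m (Suc n)) = 0"
        "\<And>m. ?H m n (G n m) (G n (Suc m))" "\<And>k. k \<le> d \<Longrightarrow> G n 0 k = Q n k"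
      by auto
    note Vn = Vstep[OF IH(1,2)]
    have top: "proper_top d (G (Suc n) m) (u m (Suc n))" for m
      using proper_top_transport[OF null null V labels(2) IH(1,2) Vn] .
    have hor: "?H m (Suc n) (G (Suc n) m) (G (Suc n) (Suc m))" for m
      using bianchi_square.edge_property_opposite[OF sq IH(3) Vn Vn] .
    have cong: "poly_eval d (G n 0) = poly_eval d (Q n)"
      using IH(4) by (auto simp: poly_eval_def fun_eq_iff)
    have axis: "G (Suc n) 0 k = Q (Suc n) k" if "k \<le> d" for k
      using edge_property_unique[OF _ Q(1) that] Vn[of 0] unfolding edge_property_def cong by blast
    have perp: "pmetric (poly_eval d (G (Suc n) m) (\<nu> (Suc n))) (u m (Suc (Suc n))) = 0" for m
    proof (induction m)
      case 0
      have "poly_eval d (G (Suc n) 0) = poly_eval d (Q (Suc n))"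
        using axis by (auto simp: poly_eval_def fun_eq_iff)
      then show ?case using Q(2)[of "Suc n"] by simp
    next
      case (Suc m)
      show ?case using bianchi_square.perp_transport[OF sq hor Suc] .
    qed
    show ?case using top hor perp axis by blast
  qed
  have top': "proper_top d (G n m) (u m n)" and H': "?H m n (G n m) (G n (Suc m))"
    and V': "?V m n (G n m) (G (Suc n) m)" for m n
    using main[of n] Vstep by auto
  let ?F = "\<lambda>(m, n). span {u m n}" and ?lab = "grid_label \<mu> \<nu>"
  have "discrete_surface ?F"
    unfolding discrete_surface_def
  proof (intro conjI allI impI)
    show "?F i \<in> null_lines" for i using u unfolding null_lines_def by (cases i) (simp only: prod.case, blast)
    show "\<not> orthogonal_sets (?F i) (?F j)" if "adjacent i j" for i j
      using that by (rule adjacent_cases)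
        (use H V in \<open>auto simp: orthogonal_span_spans pmetric_commute\<close>)
  qed
  moreover have "edge_labeling ?lab"
    unfolding edge_labeling_def
    by (auto elim!: adjacent_cases simp: grid_label_edges labels)
  moreover have "flat_discrete_connections ?F ?lab"
    unfolding flat_discrete_connections_def discrete_connection_def Let_def
    using bianchi_square.flat[OF sq] by (auto simp: grid_label_edges fun_eq_iff)
  moreover have "discrete_conserved_quantity d ?F ?lab (\<lambda>(m, n). G n m)"
    unfolding discrete_conserved_quantity_def
  proof (intro conjI allI impI)
    show "(case i of (m, n) \<Rightarrow> G n m) d \<noteq> 0" for i
    proof (cases i)
      case (Pair m n)
      have "G n m d \<noteq> 0" using top'[where m = m and n = n] span_zero[of "{u m n}"] unfolding proper_top_def by metis
      then show ?thesis by (simp add: Pair)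
    qed
    fix i j :: vertex and t assume ij: "adjacent i j \<and> t \<noteq> ?lab {i, j}"
    from ij have "adjacent i j" by simp
    then show "discrete_connection ?F ?lab t j i (poly_eval d (case i of (m, n) \<Rightarrow> G n m) t)
        = poly_eval d (case j of (m, n) \<Rightarrow> G n m) t"
    proof (cases rule: adjacent_cases)
      case (1 m n) then show ?thesis using ij H'[where m = m and n = n]
        by (simp add: discrete_connection_def edge_property_def grid_label_edges)
    next
      case (2 m n) then show ?thesis using ij V'[where m = m and n = n]
        by (simp add: discrete_connection_def edge_property_def grid_label_edges)
    next
      case (3 m n) then show ?thesis using ij edge_property_reverse[OF null null H labels(1) H'[where m = m and n = n]]
        by (simp add: discrete_connection_def edge_property_def grid_label_edges)
    next
      case (4 m n) then show ?thesis using ij edge_property_reverse[OF null null V labels(2) V'[where m = m and n = n]]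
        by (simp add: discrete_connection_def edge_property_def grid_label_edges)
    qed
  qed
  ultimately show ?thesis
    unfolding discrete_special_isothermic_def discrete_isothermic_labeling_def by blast
qed

section \<open>Directional derivatives\<close>

lemma dderiv_eqI: "(f has_derivative F) (at y) \<Longrightarrow> dderiv X f y = F X"
  by (simp add: dderiv_def frechet_derivative_at[symmetric])

lemma has_derivative_dderiv:
  "f differentiable (at y) \<Longrightarrow> (f has_derivative (\<lambda>X. dderiv X f y)) (at y)"
  by (simp add: dderiv_def frechet_derivative_works)

lemma linear_dderiv: "f differentiable (at y) \<Longrightarrow> linear (\<lambda>X. dderiv X f y)"
  using has_derivative_dderiv has_derivative_linear by blast

lemma dderiv_cong:
  assumes "open U" "y \<in> U" "\<And>z. z \<in> U \<Longrightarrow> f z = g z"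
  shows "dderiv X f y = dderiv X g y"
proof -
  have "(f has_derivative F) (at y) \<longleftrightarrow> (g has_derivative F) (at y)" for F
    by (rule iffI; erule has_derivative_transform_within_open[OF _ assms(1,2)]; simp add: assms(3))
  then show ?thesis by (simp add: dderiv_def frechet_derivative_def)
qed

lemma differentiable_cong_open:
  assumes "open U" "y \<in> U" "\<And>z. z \<in> U \<Longrightarrow> f z = g z" "f differentiable (at y)"
  shows "g differentiable (at y)"
  using assms by (meson differentiable_def has_derivative_transform_within_open)

lemma pmetric_conv_inner: "pmetric v w = v \<bullet> (fst w, - snd w)"
  by (simp add: pmetric_def inner_prod_def)

lemma norm_pmetric_le: "\<bar>pmetric v w\<bar> \<le> norm v * norm w"
proof -
  have "norm (fst w, - snd w) = norm w" by (simp add: norm_prod_def)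
  then show ?thesis unfolding pmetric_conv_inner by (metis Cauchy_Schwarz_ineq2)
qed

lemma bounded_bilinear_pmetric:
  "bounded_bilinear (pmetric :: ('p::finite, 'q::finite) ambient \<Rightarrow> _)"
proof
  show "\<exists>K. \<forall>a b :: ('p, 'q) ambient. norm (pmetric a b) \<le> norm a * norm b * K"
    by (rule exI[of _ 1]) (simp add: norm_pmetric_le)
qed (simp_all add: pmetric_linear)

lemma pmetric_nondegenerate:
  fixes v :: "('p::finite, 'q::finite) ambient"
  assumes "\<And>w. pmetric v w = 0"
  shows "v = 0"
  using assms[of "(fst v, - snd v)"] by (simp add: pmetric_conv_inner prod_eq_iff[symmetric])

lemma pmetric_dual_vector:
  fixes v :: "('p::finite, 'q::finite) ambient"
  assumes "v \<noteq> 0" obtains w where "pmetric v w \<noteq> 0"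
  using assms pmetric_nondegenerate by blast

lemma continuous_on_pmetric:
  "continuous_on A F \<Longrightarrow> continuous_on A G \<Longrightarrow> continuous_on A (\<lambda>z. pmetric (F z) (G z))"
  by (rule bounded_bilinear.continuous_on[OF bounded_bilinear_pmetric])

lemma dderiv_pmetric:
  assumes "F differentiable (at y)" "G differentiable (at y)"
  shows "dderiv X (\<lambda>z. pmetric (F z) (G z)) y
    = pmetric (dderiv X F y) (G y) + pmetric (F y) (dderiv X G y)"
  using dderiv_eqI[OF bounded_bilinear.FDERIV[OF bounded_bilinear_pmetric
      has_derivative_dderiv[OF assms(1)] has_derivative_dderiv[OF assms(2)]]] by simp

lemma differentiable_pmetric:
  assumes "F differentiable (at y)" "G differentiable (at y)"
  shows "(\<lambda>z. pmetric (F z) (G z)) differentiable (at y)"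
  using bounded_bilinear.FDERIV[OF bounded_bilinear_pmetric
      has_derivative_dderiv[OF assms(1)] has_derivative_dderiv[OF assms(2)]]
  by (rule differentiableI)

lemma dderiv_scaleR:
  assumes "g differentiable (at y)" "F differentiable (at y)"
  shows "dderiv X (\<lambda>z. g z *\<^sub>R F z) y = dderiv X g y *\<^sub>R F y + g y *\<^sub>R dderiv X F y"
  using dderiv_eqI[OF has_derivative_scaleR[OF has_derivative_dderiv[OF assms(1)]
      has_derivative_dderiv[OF assms(2)]]] by simp

lemma dderiv_mult:
  fixes g h :: "'a::real_normed_vector \<Rightarrow> real"
  assumes "g differentiable (at y)" "h differentiable (at y)"
  shows "dderiv X (\<lambda>z. g z * h z) y = dderiv X g y * h y + g y * dderiv X h y"
  using dderiv_scaleR[OF assms] by simp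

lemma dderiv_diff:
  assumes "F differentiable (at y)" "G differentiable (at y)"
  shows "dderiv X (\<lambda>z. F z - G z) y = dderiv X F y - dderiv X G y"
  by (rule dderiv_eqI[OF has_derivative_diff[OF has_derivative_dderiv[OF assms(1)]
      has_derivative_dderiv[OF assms(2)]]])

lemma dderiv_add:
  assumes "F differentiable (at y)" "G differentiable (at y)"
  shows "dderiv X (\<lambda>z. F z + G z) y = dderiv X F y + dderiv X G y"
  by (rule dderiv_eqI[OF has_derivative_add[OF has_derivative_dderiv[OF assms(1)]
      has_derivative_dderiv[OF assms(2)]]])

lemma dderiv_minus: "F differentiable (at y) \<Longrightarrow> dderiv X (\<lambda>z. - F z) y = - dderiv X F y"
  by (rule dderiv_eqI[OF has_derivative_minus[OF has_derivative_dderiv]])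

lemma dderiv_const [simp]: "dderiv X (\<lambda>z. c) y = 0"
  by (rule dderiv_eqI) (rule has_derivative_const)

lemma dderiv_inner:
  assumes "F differentiable (at y)"
  shows "dderiv X (\<lambda>z. F z \<bullet> b) y = dderiv X F y \<bullet> b"
  by (rule dderiv_eqI[OF has_derivative_inner_left[OF has_derivative_dderiv[OF assms]]])

lemma differentiable_inner_left:
  "F differentiable (at y) \<Longrightarrow> (\<lambda>z. F z \<bullet> b) differentiable (at y)"
  by (rule differentiableI[OF has_derivative_inner_left[OF has_derivative_dderiv]])

text \<open>
  The mean value theorem in direction \<open>X\<close> turns the second difference into the increment of the
  derivative \<open>dderiv X f\<close> along \<open>s *\<^sub>R Y\<close>, which differentiability at \<open>y\<close> alone controls to first
  order. The difference quotient is symmetric in \<open>X\<close> and \<open>Y\<close>, whence the symmetry of second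
  derivatives.
\<close>
lemma second_difference_tendsto:
  fixes f :: "'a::real_normed_vector \<Rightarrow> real"
  assumes "open D" "y \<in> D" and f: "\<And>z. z \<in> D \<Longrightarrow> f differentiable (at z)"
    and g: "dderiv X f differentiable (at y)"
  shows "((\<lambda>s. (f (y + s *\<^sub>R X + s *\<^sub>R Y) - f (y + s *\<^sub>R X) - f (y + s *\<^sub>R Y) + f y) / s\<^sup>2)
     \<longlongrightarrow> dderiv Y (dderiv X f) y) (at_right 0)"
proof (rule tendstoI)
  fix e :: real assume e: "e > 0"
  define g where "g = dderiv X f"
  define A where "A h = dderiv h g y" for h
  \<comment> \<open>All base points involved lie within \<open>s * N\<close> of \<open>y\<close>; the 1 makes \<open>N\<close> positive.\<close>
  define N where "N = norm X + norm Y + 1"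
  have N: "N > 0" by (simp add: N_def add_nonneg_pos)
  have A: "(g has_derivative A) (at y)"
    using has_derivative_dderiv[OF assms(4)] by (simp add: g_def A_def[abs_def])
  interpret A: bounded_linear A using A by (rule has_derivative_bounded_linear)
  obtain \<delta> where \<delta>: "\<delta> > 0"
      "\<And>z. norm (z - y) < \<delta> \<Longrightarrow> norm (g z - g y - A (z - y)) \<le> e / (4 * N) * norm (z - y)"
    using A e N unfolding has_derivative_at_alt by (metis divide_pos_pos mult_pos_pos zero_less_numeral)
  obtain r where r: "r > 0" "ball y r \<subseteq> D" using assms(1,2) openE by blast
  define s0 where "s0 = min \<delta> r / N"
  have s0: "s0 > 0" using \<delta>(1) r(1) N by (simp add: s0_def)
  show "eventually (\<lambda>s. dist ((f (y + s *\<^sub>R X + s *\<^sub>R Y) - f (y + s *\<^sub>R X) - f (y + s *\<^sub>R Y) + f y) / s\<^sup>2)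
      (dderiv Y (dderiv X f) y) < e) (at_right 0)"
    unfolding eventually_at_right_field
  proof (intro exI[of _ s0] conjI allI impI)
    fix s :: real assume s: "0 < s" "s < s0"
    have small: "norm (\<theta> *\<^sub>R X + \<tau> *\<^sub>R Y) \<le> s * N" "s * N < \<delta>" "s * N < r"
      if "0 \<le> \<theta>" "\<theta> \<le> s" "0 \<le> \<tau>" "\<tau> \<le> s" for \<theta> \<tau>
    proof -
      have "norm (\<theta> *\<^sub>R X + \<tau> *\<^sub>R Y) \<le> \<theta> * norm X + \<tau> * norm Y"
        using that by (metis norm_scaleR norm_triangle_ineq abs_of_nonneg)
      also have "\<dots> \<le> s * norm X + s * norm Y"
        using that by (intro add_mono mult_right_mono) auto
      also have "\<dots> \<le> s * N" using s by (simp add: N_def algebra_simps)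
      finally show "norm (\<theta> *\<^sub>R X + \<tau> *\<^sub>R Y) \<le> s * N" .
      have "s * N < s0 * N" using s N by simp
      also have "\<dots> = min \<delta> r" using N by (simp add: s0_def)
      finally show "s * N < \<delta>" "s * N < r" by auto
    qed
    have inD: "y + (\<theta> *\<^sub>R X + \<tau> *\<^sub>R Y) \<in> D" if "0 \<le> \<theta>" "\<theta> \<le> s" "0 \<le> \<tau>" "\<tau> \<le> s" for \<theta> \<tau>
    proof -
      have "dist y (y + (\<theta> *\<^sub>R X + \<tau> *\<^sub>R Y)) = norm (\<theta> *\<^sub>R X + \<tau> *\<^sub>R Y)"
        by (metis add_diff_cancel_left' dist_commute dist_norm)
      then show ?thesis using small[OF that] r(2) by (auto simp: subset_eq)
    qed
    have est: "\<bar>g (y + (\<theta> *\<^sub>R X + \<tau> *\<^sub>R Y)) - g y - A (\<theta> *\<^sub>R X + \<tau> *\<^sub>R Y)\<bar> \<le> e / 4 * s"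
      if "0 \<le> \<theta>" "\<theta> \<le> s" "0 \<le> \<tau>" "\<tau> \<le> s" for \<theta> \<tau>
    proof -
      have "\<bar>g (y + (\<theta> *\<^sub>R X + \<tau> *\<^sub>R Y)) - g y - A (\<theta> *\<^sub>R X + \<tau> *\<^sub>R Y)\<bar>
          \<le> e / (4 * N) * norm (\<theta> *\<^sub>R X + \<tau> *\<^sub>R Y)"
        using \<delta>(2)[of "y + (\<theta> *\<^sub>R X + \<tau> *\<^sub>R Y)"] small[OF that] by simp
      also have "\<dots> \<le> e / (4 * N) * (s * N)"
        using small(1)[OF that] e N by (intro mult_left_mono) auto
      also have "\<dots> = e / 4 * s" using N by simp
      finally show ?thesis .
    qed
    have deriv: "((\<lambda>\<theta>. f (y + (\<theta> *\<^sub>R X + \<tau> *\<^sub>R Y))) has_real_derivative g (y + (\<theta> *\<^sub>R X + \<tau> *\<^sub>R Y))) (at \<theta>)"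
      if "0 \<le> \<theta>" "\<theta> \<le> s" "0 \<le> \<tau>" "\<tau> \<le> s" for \<theta> \<tau>
    proof -
      let ?z = "y + (\<theta> *\<^sub>R X + \<tau> *\<^sub>R Y)"
      have "((\<lambda>\<theta>. y + (\<theta> *\<^sub>R X + \<tau> *\<^sub>R Y)) has_derivative (\<lambda>h. h *\<^sub>R X)) (at \<theta>)"
        by (auto intro!: derivative_eq_intros)
      from diff_chain_at[OF this has_derivative_dderiv[OF f[OF inD[OF that]]]]
      have "((\<lambda>\<theta>. f (y + (\<theta> *\<^sub>R X + \<tau> *\<^sub>R Y))) has_derivative (\<lambda>h. dderiv (h *\<^sub>R X) f ?z)) (at \<theta>)"
        by (simp add: o_def)
      moreover have "dderiv (h *\<^sub>R X) f ?z = g ?z * h" for h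
        using linear_scale[OF linear_dderiv[OF f[OF inD[OF that]]], of h X] by (simp add: g_def)
      ultimately show ?thesis by (simp add: has_field_derivative_def)
    qed
    define \<phi> where "\<phi> \<theta> = f (y + (\<theta> *\<^sub>R X + s *\<^sub>R Y)) - f (y + (\<theta> *\<^sub>R X + 0 *\<^sub>R Y))" for \<theta>
    have "\<exists>\<theta>>0. \<theta> < s \<and> \<phi> s - \<phi> 0
        = (s - 0) * (g (y + (\<theta> *\<^sub>R X + s *\<^sub>R Y)) - g (y + (\<theta> *\<^sub>R X + 0 *\<^sub>R Y)))"
      unfolding \<phi>_def using s by (intro MVT2 DERIV_diff deriv) auto
    then obtain \<theta> where \<theta>: "0 < \<theta>" "\<theta> < s" "\<phi> s - \<phi> 0
        = s * (g (y + (\<theta> *\<^sub>R X + s *\<^sub>R Y)) - g (y + (\<theta> *\<^sub>R X + 0 *\<^sub>R Y)))" by auto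
    define \<Delta> where "\<Delta> = f (y + s *\<^sub>R X + s *\<^sub>R Y) - f (y + s *\<^sub>R X) - f (y + s *\<^sub>R Y) + f y"
    have "\<Delta> = \<phi> s - \<phi> 0" by (simp add: \<phi>_def \<Delta>_def add.assoc)
    then have "\<Delta> / s\<^sup>2 = (g (y + (\<theta> *\<^sub>R X + s *\<^sub>R Y)) - g (y + (\<theta> *\<^sub>R X + 0 *\<^sub>R Y))) / s"
      using s \<theta>(3) by (simp add: power2_eq_square)
    then have "\<Delta> / s\<^sup>2 - A Y = (g (y + (\<theta> *\<^sub>R X + s *\<^sub>R Y)) - g (y + (\<theta> *\<^sub>R X + 0 *\<^sub>R Y)) - s * A Y) / s"
      using s by (simp add: diff_divide_distrib)
    moreover have "\<bar>g (y + (\<theta> *\<^sub>R X + s *\<^sub>R Y)) - g (y + (\<theta> *\<^sub>R X + 0 *\<^sub>R Y)) - s * A Y\<bar> \<le> e / 2 * s"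
    proof -
      let ?z = "\<lambda>\<tau>. \<theta> *\<^sub>R X + \<tau> *\<^sub>R Y"
      have "g (y + ?z s) - g (y + ?z 0) - s * A Y
          = (g (y + ?z s) - g y - A (?z s)) - (g (y + ?z 0) - g y - A (?z 0))"
        by (simp add: A.add A.scaleR)
      then have "\<bar>g (y + ?z s) - g (y + ?z 0) - s * A Y\<bar> \<le> e / 4 * s + e / 4 * s"
        using est[of \<theta> s] est[of \<theta> 0] \<theta>(1,2) s by (simp only: order.trans[OF abs_triangle_ineq4 add_mono])
      then show ?thesis by simp
    qed
    ultimately have "\<bar>\<Delta> / s\<^sup>2 - A Y\<bar> \<le> e / 2"
      using s by (simp add: abs_divide divide_le_eq)
    then show "dist (\<Delta> / s\<^sup>2) (dderiv Y (dderiv X f) y) < e"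
      using e by (simp add: dist_real_def A_def g_def)
  qed (use s0 in auto)
qed

lemma dderiv_commute:
  fixes f :: "'a::real_normed_vector \<Rightarrow> 'b::euclidean_space"
  assumes D: "open D" "y \<in> D" and f: "\<And>z. z \<in> D \<Longrightarrow> f differentiable (at z)"
    and g: "\<And>X. dderiv X f differentiable (at y)"
  shows "dderiv X (dderiv Y f) y = dderiv Y (dderiv X f) y"
proof (rule euclidean_eqI)
  fix b :: 'b
  let ?f = "\<lambda>z. f z \<bullet> b"
  have f': "?f differentiable (at z)" if "z \<in> D" for z
    using f[OF that] by (rule differentiable_inner_left)
  have cong: "dderiv X f z \<bullet> b = dderiv X ?f z" if "z \<in> D" for X z
    using dderiv_inner[OF f[OF that]] by simp
  have g': "dderiv X ?f differentiable (at y)" for X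
    by (rule differentiable_cong_open[OF D cong differentiable_inner_left[OF g]])
  have "dderiv X (dderiv Y f) y \<bullet> b = dderiv X (dderiv Y ?f) y" for X Y
    by (simp only: dderiv_inner[OF g, symmetric] dderiv_cong[OF D cong])
  moreover have swap: "y + s *\<^sub>R X + s *\<^sub>R Y = y + s *\<^sub>R Y + s *\<^sub>R X" for s
    by simp
  have "dderiv X (dderiv Y ?f) y = dderiv Y (dderiv X ?f) y"
  proof (rule tendsto_unique)
    show "((\<lambda>s. (?f (y + s *\<^sub>R Y + s *\<^sub>R X) - ?f (y + s *\<^sub>R Y) - ?f (y + s *\<^sub>R X) + ?f y) / s\<^sup>2)
      \<longlongrightarrow> dderiv X (dderiv Y ?f) y) (at_right 0)"
      by (rule second_difference_tendsto[OF D f' g'])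
    show "((\<lambda>s. (?f (y + s *\<^sub>R Y + s *\<^sub>R X) - ?f (y + s *\<^sub>R Y) - ?f (y + s *\<^sub>R X) + ?f y) / s\<^sup>2)
      \<longlongrightarrow> dderiv Y (dderiv X ?f) y) (at_right 0)"
    proof -
      have "((\<lambda>s. (?f (y + s *\<^sub>R X + s *\<^sub>R Y) - ?f (y + s *\<^sub>R X) - ?f (y + s *\<^sub>R Y) + ?f y) / s\<^sup>2)
        \<longlongrightarrow> dderiv Y (dderiv X ?f) y) (at_right 0)"
        by (rule second_difference_tendsto[OF D f' g'])
      moreover have "?f (y + s *\<^sub>R X + s *\<^sub>R Y) - ?f (y + s *\<^sub>R X) - ?f (y + s *\<^sub>R Y) + ?f y
          = ?f (y + s *\<^sub>R Y + s *\<^sub>R X) - ?f (y + s *\<^sub>R Y) - ?f (y + s *\<^sub>R X) + ?f y" for s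
        by (simp only: swap)
      ultimately show ?thesis by simp
    qed
  qed simp
  ultimately show "dderiv X (dderiv Y f) y \<bullet> b = dderiv Y (dderiv X f) y \<bullet> b" by simp
qed

text \<open>
  Uniqueness for linear differential equations: a map whose derivative is bounded by a multiple of
  the map itself cannot leave 0. The multiple is bounded along a segment by compactness.
\<close>
lemma gronwall_vanishing:
  fixes W :: "'a::real_normed_vector \<Rightarrow> 'b::real_inner"
  assumes D: "convex D" "y \<in> D" "y' \<in> D" and W: "\<And>z. z \<in> D \<Longrightarrow> W differentiable (at z)"
    and C: "continuous_on D C"
    and bound: "\<And>z X. z \<in> D \<Longrightarrow> norm (dderiv X W z) \<le> C z * norm X * norm (W z)"
    and zero: "W y = 0"
  shows "W y' = 0"
proof -
  define X where "X = y' - y"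
  define c where "c t = y + t *\<^sub>R X" for t
  have inD: "c t \<in> D" if "0 \<le> t" "t \<le> 1" for t
  proof -
    have "c t = (1 - t) *\<^sub>R y + t *\<^sub>R y'" by (simp add: c_def X_def algebra_simps)
    then show ?thesis using D that by (simp add: convexD)
  qed
  have "continuous_on {0..1} (\<lambda>t. C (c t))"
    by (rule continuous_on_compose2[OF C]) (use inD in \<open>auto simp: c_def intro!: continuous_intros\<close>)
  then have "bdd_above ((\<lambda>t. C (c t)) ` {0..1})"
    by (intro bounded_imp_bdd_above compact_imp_bounded compact_continuous_image compact_Icc)
  then obtain M where "\<forall>x\<in>(\<lambda>t. C (c t)) ` {0..1}. x \<le> M"
    unfolding bdd_above_def by blast
  then have M: "C (c t) \<le> M" if "0 \<le> t" "t \<le> 1" for t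
    using that by simp
  define K where "K = M * norm X"
  define h where "h t = W (c t)" for t
  define h' where "h' t = dderiv X W (c t)" for t
  have h: "(h has_vector_derivative h' t) (at t)" if "0 \<le> t" "t \<le> 1" for t
  proof -
    have "(c has_derivative (\<lambda>s. s *\<^sub>R X)) (at t)"
      unfolding c_def[abs_def] by (auto intro!: derivative_eq_intros)
    from diff_chain_at[OF this has_derivative_dderiv[OF W[OF inD[OF that]]]]
    have "(h has_derivative (\<lambda>s. dderiv (s *\<^sub>R X) W (c t))) (at t)"
      by (simp add: o_def h_def[abs_def])
    then show ?thesis
      using linear_scale[OF linear_dderiv[OF W[OF inD[OF that]]]]
      by (simp add: has_vector_derivative_def h'_def)
  qed
  \<comment> \<open>The squared norm along the segment, damped at its largest possible rate of growth.\<close>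
  define \<phi> where "\<phi> t = exp (- 2 * K * t) * (h t \<bullet> h t)" for t
  have "\<phi> 1 \<le> \<phi> 0"
  proof (rule DERIV_nonpos_imp_nonincreasing[of 0 1])
    fix t :: real assume t: "0 \<le> t" "t \<le> 1"
    have "(h has_derivative (\<lambda>s. s *\<^sub>R h' t)) (at t)"
      using h[OF t] by (simp add: has_vector_derivative_def)
    then have "(\<phi> has_real_derivative exp (- 2 * K * t) * (2 * (h t \<bullet> h' t) - 2 * K * (h t \<bullet> h t))) (at t)"
      unfolding \<phi>_def[abs_def] has_field_derivative_def
      by (auto intro!: derivative_eq_intros simp: inner_commute algebra_simps)
    moreover have "h t \<bullet> h' t \<le> K * (h t \<bullet> h t)"
    proof -
      have "h t \<bullet> h' t \<le> norm (h t) * norm (h' t)" by (rule norm_cauchy_schwarz)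
      also have "\<dots> \<le> norm (h t) * (C (c t) * norm X * norm (h t))"
        using bound[OF inD[OF t]] by (intro mult_left_mono) (auto simp: h_def h'_def)
      also have "\<dots> \<le> norm (h t) * (M * norm X * norm (h t))"
        using M[OF t] by (intro mult_left_mono mult_right_mono) auto
      also have "\<dots> = K * (h t \<bullet> h t)"
        by (simp add: K_def power2_norm_eq_inner[symmetric] power2_eq_square)
      finally show ?thesis .
    qed
    then have "exp (- 2 * K * t) * (2 * (h t \<bullet> h' t) - 2 * K * (h t \<bullet> h t)) \<le> 0"
      by (intro mult_nonneg_nonpos) auto
    ultimately show "\<exists>y. (\<phi> has_real_derivative y) (at t) \<and> y \<le> 0" by blast
  qed simp
  moreover have "\<phi> 0 = 0" by (simp add: \<phi>_def h_def c_def zero)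
  ultimately have "h 1 \<bullet> h 1 \<le> 0" by (simp add: \<phi>_def mult_le_0_iff not_le)
  then have "h 1 = 0" by (metis inner_eq_zero_iff inner_ge_zero order_antisym)
  then show ?thesis by (simp add: h_def c_def X_def)
qed

section \<open>Isothermic forms in curvature line coordinates\<close>

lemma partial_u_apply: "partial_u f = dderiv (axis 1 1) f"
  and partial_v_apply: "partial_v f = dderiv (axis 2 1) f"
  by (simp_all add: partial_u_def partial_v_def)

lemma linear_real2:
  fixes F :: "real^2 \<Rightarrow> 'b::real_vector"
  assumes "linear F"
  shows "F X = X $ 1 *\<^sub>R F (axis 1 1) + X $ 2 *\<^sub>R F (axis 2 1)"
proof -
  interpret linear F by (rule assms)
  have "X = X $ 1 *\<^sub>R axis 1 1 + X $ 2 *\<^sub>R axis 2 1"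
    by (simp add: vec_eq_iff forall_2 axis_def)
  then have "F X = F (X $ 1 *\<^sub>R axis 1 1 + X $ 2 *\<^sub>R axis 2 1)" by simp
  then show ?thesis by (simp add: add scale)
qed

lemma wedge_add_multiple: "wedge u (v + c *\<^sub>R u) w = wedge u v w"
  by (simp add: wedge_def pmetric_linear algebra_simps)

lemma wedge_minus_right: "wedge u (- v) w = - wedge u v w"
  by (simp add: wedge_def pmetric_linear)

lemma wedge_scaleR_right: "wedge u (c *\<^sub>R v) w = c *\<^sub>R wedge u v w"
  by (simp add: wedge_def pmetric_linear algebra_simps)

text \<open>
  The tangent space spanned by \<open>p\<close>, \<open>a\<close> and \<open>b\<close> equals the orthogonal space of its orthogonal
  space. The metric is degenerate on it, with radical spanned by the null vector \<open>p\<close>, so the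
  orthogonal projection to it does not exist; the vector \<open>\<xi>\<close>, made orthogonal to \<open>a\<close> and \<open>b\<close>, takes
  the place of a dual vector to \<open>p\<close>.
\<close>
lemma frame_double_perp:
  fixes p a b w \<xi> :: "('p::finite, 'q::finite) ambient"
  assumes p: "pmetric p p = 0" "pmetric p a = 0" "pmetric p b = 0" and ab: "pmetric a b = 0"
    and nz: "pmetric a a \<noteq> 0" "pmetric b b \<noteq> 0" and \<xi>: "pmetric p \<xi> \<noteq> 0"
    and w: "pmetric w p = 0"
      "\<And>z. pmetric p z = 0 \<Longrightarrow> pmetric a z = 0 \<Longrightarrow> pmetric b z = 0 \<Longrightarrow> pmetric w z = 0"
  obtains c where "w = (pmetric w a / pmetric a a) *\<^sub>R a + (pmetric w b / pmetric b b) *\<^sub>R b + c *\<^sub>R p"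
proof -
  define w0 where "w0 = w - (pmetric w a / pmetric a a) *\<^sub>R a - (pmetric w b / pmetric b b) *\<^sub>R b"
  define c where "c = pmetric w0 \<xi> / pmetric p \<xi>"
  define w' where "w' = w0 - c *\<^sub>R p"
  have sym: "pmetric a p = 0" "pmetric b p = 0" "pmetric b a = 0"
    using p ab by (simp_all add: pmetric_commute)
  have w': "pmetric w' p = 0" "pmetric w' a = 0" "pmetric w' b = 0" "pmetric w' \<xi> = 0"
    using p ab nz \<xi> w(1) sym by (simp_all add: w'_def w0_def c_def pmetric_linear)
  have w'z: "pmetric w' z = 0" if "pmetric p z = 0" "pmetric a z = 0" "pmetric b z = 0" for z
    using that w(2)[OF that] by (simp add: w'_def w0_def pmetric_linear)
  \<comment> \<open>\<open>w'\<close> annihilates \<open>p\<close>, \<open>a\<close>, \<open>b\<close>, \<open>\<xi>\<close> and the vectors orthogonal to the tangent space, which span.\<close>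
  have "w' = 0"
  proof (rule pmetric_nondegenerate)
    fix z
    define proj where "proj u = u - (pmetric a u / pmetric a a) *\<^sub>R a - (pmetric b u / pmetric b b) *\<^sub>R b" for u
    have proj: "pmetric p (proj u) = pmetric p u" "pmetric a (proj u) = 0" "pmetric b (proj u) = 0"
      "pmetric w' (proj u) = pmetric w' u" for u
      using p ab nz sym w' by (simp_all add: proj_def pmetric_linear)
    define k where "k = pmetric p z / pmetric p \<xi>"
    have "pmetric w' (proj z - k *\<^sub>R proj \<xi>) = 0"
      using \<xi> by (intro w'z) (simp_all add: pmetric_linear proj k_def)
    then show "pmetric w' z = 0" by (simp add: pmetric_linear proj w')
  qed
  then have "w = (pmetric w a / pmetric a a) *\<^sub>R a + (pmetric w b / pmetric b b) *\<^sub>R b + c *\<^sub>R p"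
    by (simp add: w'_def w0_def algebra_simps)
  then show thesis by (rule that)
qed

lemma smooth_on_differentiable:
  assumes "smooth_on D f" "y \<in> D" shows "f differentiable (at y)"
  using assms unfolding smooth_on_def by (metis Ck_on.simps(2))

lemma smooth_on_dderiv: "smooth_on D f \<Longrightarrow> smooth_on D (dderiv X f)"
  unfolding smooth_on_def by (metis Ck_on.simps(2))

lemma smooth_on_continuous: "smooth_on D f \<Longrightarrow> continuous_on D f"
  unfolding smooth_on_def by (metis Ck_on.simps(1))

lemma smooth_on_subset:
  assumes "U \<subseteq> D" shows "smooth_on D f \<Longrightarrow> smooth_on U f"
proof -
  have "Ck_on k D f \<Longrightarrow> Ck_on k U f" for k
    using assms by (induction k arbitrary: f) (auto intro: continuous_on_subset)
  then show "smooth_on D f \<Longrightarrow> smooth_on U f" by (simp add: smooth_on_def)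
qed

text \<open>
  A piece of an isothermic surface in conformal curvature line coordinates, with a lift \<open>\<psi>\<close> and the
  coordinate expression of its closed form. The constant vector \<open>\<xi>\<close> is nowhere orthogonal to the
  lift; it serves to select representatives of vectors that are only determined modulo \<open>\<psi>\<close>.
  Convexity gives constancy from vanishing derivatives and provides segments for the uniqueness
  argument below.
\<close>
locale isothermic_patch =
  fixes D :: "(real^2) set" and \<psi> :: "real^2 \<Rightarrow> ('p::finite, 'q::finite) ambient"
    and \<epsilon> :: real and \<xi> :: "('p, 'q) ambient"
    and \<eta> :: "real^2 \<Rightarrow> real^2 \<Rightarrow> ('p, 'q) ambient \<Rightarrow> ('p, 'q) ambient"
  assumes open_D: "open D" and convex_D: "convex D" and smooth: "smooth_on D \<psi>"
    and null: "\<And>y. y \<in> D \<Longrightarrow> pmetric (\<psi> y) (\<psi> y) = 0"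
    and transversal: "\<And>y. y \<in> D \<Longrightarrow> pmetric (\<psi> y) \<xi> \<noteq> 0"
    and sign: "\<epsilon> \<in> {1, -1}"
    and conformal: "\<And>y. y \<in> D \<Longrightarrow> pmetric (partial_u \<psi> y) (partial_u \<psi> y) \<noteq> 0"
      "\<And>y. y \<in> D \<Longrightarrow> pmetric (partial_v \<psi> y) (partial_v \<psi> y)
        = \<epsilon> * pmetric (partial_u \<psi> y) (partial_u \<psi> y)"
      "\<And>y. y \<in> D \<Longrightarrow> pmetric (partial_u \<psi> y) (partial_v \<psi> y) = 0"
    and curvature_line: "\<And>y. y \<in> D \<Longrightarrow> partial_u (partial_v \<psi>) y \<in> tangent_space \<psi> y"
    and not_umbilic: "\<And>y. y \<in> D \<Longrightarrow> \<not> umbilic \<psi> y"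
    and \<eta>_smooth: "\<And>X w. smooth_on D (\<lambda>y. \<eta> y X w)"
    and \<eta>_closed: "\<And>y X Y w. y \<in> D \<Longrightarrow> dderiv X (\<lambda>z. \<eta> z Y w) y = dderiv Y (\<lambda>z. \<eta> z X w) y"
    and \<eta>_linear: "\<And>y w. y \<in> D \<Longrightarrow> linear (\<lambda>X. \<eta> y X w)"
    and \<eta>_wedge: "\<And>y X. y \<in> D \<Longrightarrow> \<eta> y X \<in> wedge_perp (span {\<psi> y})"
begin

abbreviation "e1 \<equiv> axis 1 1 :: real^2"
abbreviation "e2 \<equiv> axis 2 1 :: real^2"
abbreviation "\<psi>u \<equiv> partial_u \<psi>"
abbreviation "\<psi>v \<equiv> partial_v \<psi>"
abbreviation "\<psi>uu \<equiv> partial_u (partial_u \<psi>)"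
abbreviation "\<psi>uv \<equiv> partial_u (partial_v \<psi>)"
abbreviation "\<psi>vv \<equiv> partial_v (partial_v \<psi>)"

definition "E y = pmetric (\<psi>u y) (\<psi>u y)"

lemma smooth_derivs: "smooth_on D \<psi>u" "smooth_on D \<psi>v" "smooth_on D \<psi>uu" "smooth_on D \<psi>vv"
  unfolding partial_u_def partial_v_def using smooth by (simp_all add: smooth_on_dderiv)

lemma diff:
  assumes "y \<in> D"
  shows "\<psi> differentiable (at y)" "\<psi>u differentiable (at y)" "\<psi>v differentiable (at y)"
  using smooth smooth_derivs smooth_on_differentiable assms by blast+

lemma mixed: "partial_v \<psi>u y = \<psi>uv y" if "y \<in> D"
  unfolding partial_u_def partial_v_def
  by (rule dderiv_commute[OF open_D that])
    (auto intro: smooth_on_differentiable smooth_on_dderiv smooth that)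

lemma frame:
  assumes y: "y \<in> D"
  shows "pmetric (\<psi> y) (\<psi>u y) = 0" "pmetric (\<psi> y) (\<psi>v y) = 0" "pmetric (\<psi>u y) (\<psi>v y) = 0"
    "pmetric (\<psi>u y) (\<psi> y) = 0" "pmetric (\<psi>v y) (\<psi> y) = 0" "pmetric (\<psi>v y) (\<psi>u y) = 0"
    "pmetric (\<psi>u y) (\<psi>u y) = E y" "pmetric (\<psi>v y) (\<psi>v y) = \<epsilon> * E y" "E y \<noteq> 0" "pmetric (\<psi> y) (\<psi> y) = 0"
proof -
  have "pmetric (\<psi> y) (dderiv X \<psi> y) = 0" for X
  proof -
    have "dderiv X (\<lambda>z. pmetric (\<psi> z) (\<psi> z)) y = dderiv X (\<lambda>z. 0 :: real) y"
      by (rule dderiv_cong[OF open_D y null])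
    then show ?thesis
      by (simp add: dderiv_pmetric diff[OF y] pmetric_commute[of "dderiv X \<psi> y"])
  qed
  then show "pmetric (\<psi> y) (\<psi>u y) = 0" "pmetric (\<psi> y) (\<psi>v y) = 0"
    by (simp_all add: partial_u_def partial_v_def)
  then show "pmetric (\<psi>u y) (\<psi> y) = 0" "pmetric (\<psi>v y) (\<psi> y) = 0"
    by (simp_all add: pmetric_commute)
  show "pmetric (\<psi>u y) (\<psi>v y) = 0" "pmetric (\<psi>v y) (\<psi>u y) = 0"
    using conformal(3)[OF y] by (simp_all add: pmetric_commute)
qed (use conformal null y in \<open>simp_all add: E_def\<close>)

lemma \<epsilon>: "\<epsilon> \<noteq> 0" "\<epsilon> * \<epsilon> = 1" "\<epsilon> * (\<epsilon> * r) = r"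
  using sign by auto

lemma perp_derivative:
  assumes y: "y \<in> D" and F: "F differentiable (at y)" and G: "G differentiable (at y)"
    and perp: "\<And>z. z \<in> D \<Longrightarrow> pmetric (F z) (G z) = 0"
  shows "pmetric (F y) (dderiv X G y) = - pmetric (dderiv X F y) (G y)"
proof -
  have "dderiv X (\<lambda>z. pmetric (F z) (G z)) y = dderiv X (\<lambda>z. 0 :: real) y"
    by (rule dderiv_cong[OF open_D y perp])
  then show ?thesis by (simp add: dderiv_pmetric F G)
qed

lemma hessian_normal:
  assumes y: "y \<in> D"
  shows "pmetric (\<psi> y) (\<psi>uu y) = - E y" "pmetric (\<psi> y) (\<psi>vv y) = - (\<epsilon> * E y)"
  using perp_derivative[OF y diff(1,2)[OF y] frame(1), of e1]
    perp_derivative[OF y diff(1,3)[OF y] frame(2), of e2] frame[OF y]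
  by (simp_all add: partial_u_def[symmetric] partial_v_def[symmetric])

lemma mixed_tangent:
  assumes y: "y \<in> D" and z: "pmetric (\<psi> y) z = 0" "pmetric (\<psi>u y) z = 0" "pmetric (\<psi>v y) z = 0"
  shows "pmetric (\<psi>uv y) z = 0"
proof -
  have "\<psi>uv y \<in> span {\<psi> y, \<psi>u y, \<psi>v y}"
    using curvature_line[OF y] by (simp add: tangent_space_def)
  moreover have "linear (\<lambda>u. pmetric u z)" by (intro linearI) (simp_all add: pmetric_linear)
  ultimately show ?thesis
    using z by (elim linear_eq_0_on_span[where f = "\<lambda>u. pmetric u z", rotated 2]) auto
qed

lemma tangent_decomp:
  assumes y: "y \<in> D" and w: "pmetric w (\<psi> y) = 0"
    "\<And>z. pmetric (\<psi> y) z = 0 \<Longrightarrow> pmetric (\<psi>u y) z = 0 \<Longrightarrow> pmetric (\<psi>v y) z = 0 \<Longrightarrow> pmetric w z = 0"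
  obtains c where "w = (pmetric w (\<psi>u y) / E y) *\<^sub>R \<psi>u y + (pmetric w (\<psi>v y) / (\<epsilon> * E y)) *\<^sub>R \<psi>v y + c *\<^sub>R \<psi> y"
  using frame_double_perp[of "\<psi> y" "\<psi>u y" "\<psi>v y" \<xi> w] frame[OF y] transversal[OF y] \<epsilon>(1) w by auto

text \<open>
  If the form is \<open>\<psi> \<and> v1\<close> in the first and \<open>\<psi> \<and> v2\<close> in the second coordinate direction, this is its
  closedness, applied to \<open>w\<close> and paired with \<open>z\<close>. All structural properties of the form result from
  special choices of \<open>w\<close> and \<open>z\<close>.
\<close>
lemma closed_wedge:
  assumes v1: "\<And>z. z \<in> D \<Longrightarrow> v1 differentiable (at z)" and v2: "\<And>z. z \<in> D \<Longrightarrow> v2 differentiable (at z)"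
    and \<eta>1: "\<And>z w. z \<in> D \<Longrightarrow> \<eta> z e1 w = wedge (\<psi> z) (v1 z) w"
    and \<eta>2: "\<And>z w. z \<in> D \<Longrightarrow> \<eta> z e2 w = wedge (\<psi> z) (v2 z) w"
    and y: "y \<in> D"
  shows "pmetric (\<psi>u y) w * pmetric (v2 y) z + pmetric (\<psi> y) w * pmetric (partial_u v2 y) z
      - pmetric (partial_u v2 y) w * pmetric (\<psi> y) z - pmetric (v2 y) w * pmetric (\<psi>u y) z
    = pmetric (\<psi>v y) w * pmetric (v1 y) z + pmetric (\<psi> y) w * pmetric (partial_v v1 y) z
      - pmetric (partial_v v1 y) w * pmetric (\<psi> y) z - pmetric (v1 y) w * pmetric (\<psi>v y) z"
proof -
  have dwedge: "dderiv X (\<lambda>z. wedge (\<psi> z) (v z) w) y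
      = pmetric (dderiv X \<psi> y) w *\<^sub>R v y + pmetric (\<psi> y) w *\<^sub>R dderiv X v y
        - (pmetric (dderiv X v y) w *\<^sub>R \<psi> y + pmetric (v y) w *\<^sub>R dderiv X \<psi> y)"
    if v: "v differentiable (at y)" for X v
  proof -
    have "(\<lambda>z. pmetric (\<psi> z) w) differentiable (at y)" "(\<lambda>z. pmetric (v z) w) differentiable (at y)"
      using v diff(1)[OF y] by (simp_all add: differentiable_pmetric)
    then show ?thesis
      using v diff(1)[OF y] unfolding wedge_def
      by (simp add: dderiv_diff dderiv_scaleR dderiv_pmetric differentiable_scaleR)
  qed
  have "dderiv e1 (\<lambda>z. wedge (\<psi> z) (v2 z) w) y = dderiv e1 (\<lambda>z. \<eta> z e2 w) y"
    by (rule dderiv_cong[OF open_D y]) (simp add: \<eta>2)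
  also have "\<dots> = dderiv e2 (\<lambda>z. \<eta> z e1 w) y" by (rule \<eta>_closed[OF y])
  also have "\<dots> = dderiv e2 (\<lambda>z. wedge (\<psi> z) (v1 z) w) y"
    by (rule dderiv_cong[OF open_D y]) (simp add: \<eta>1)
  finally have "pmetric (dderiv e1 (\<lambda>z. wedge (\<psi> z) (v2 z) w) y) z
      = pmetric (dderiv e2 (\<lambda>z. wedge (\<psi> z) (v1 z) w) y) z" by simp
  then show ?thesis
    unfolding dwedge[OF v1[OF y]] dwedge[OF v2[OF y]] partial_u_def partial_v_def
    by (simp add: pmetric_linear)
qed

text \<open>
  The second factor of the form, written as \<open>\<psi> \<and> v\<close>, is determined up to multiples of \<open>\<psi>\<close>. This is
  the choice orthogonal to \<open>\<xi>\<close>; being a value of the form itself up to scale, it is differentiable.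
\<close>
definition "leg X y = inverse (pmetric (\<psi> y) \<xi>) *\<^sub>R \<eta> y X \<xi>"

lemma leg:
  assumes y: "y \<in> D"
  shows leg_wedge: "\<eta> y X w = wedge (\<psi> y) (leg X y) w" and leg_perp: "pmetric (leg X y) (\<psi> y) = 0"
    and leg_diff: "leg X differentiable (at y)"
proof -
  obtain c v' where v': "\<eta> y X = wedge (c *\<^sub>R \<psi> y) v'" "pmetric v' (\<psi> y) = 0"
    using \<eta>_wedge[OF y, of X] unfolding wedge_perp_def orthogonal_span_single
    by (auto simp: span_singleton)
  have "leg X y = c *\<^sub>R v' + (- c * pmetric v' \<xi> / pmetric (\<psi> y) \<xi>) *\<^sub>R \<psi> y"
    using transversal[OF y] unfolding leg_def v'(1) wedge_def
    by (simp add: pmetric_linear scaleR_diff_right field_simps)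
  then show "\<eta> y X w = wedge (\<psi> y) (leg X y) w" "pmetric (leg X y) (\<psi> y) = 0"
    unfolding v'(1) using v'(2) null[OF y]
    by (simp_all only: wedge_add_multiple) (simp_all add: wedge_def pmetric_linear mult_ac)
  show "leg X differentiable (at y)"
    unfolding leg_def[abs_def]
    using smooth_on_differentiable[OF \<eta>_smooth y] transversal[OF y]
    by (intro differentiable_scaleR differentiable_inverse differentiable_pmetric diff[OF y])
      simp_all
qed

text \<open>
  A vector \<open>w = z\<close> orthogonal to the tangent space leaves in \<open>closed_wedge\<close> only multiples of the frame,
  and the coefficients of \<open>\<psi>u\<close> and \<open>\<psi>v\<close> in them are the products of \<open>z\<close> with the two legs.
\<close>
lemma leg_tangent:
  assumes y: "y \<in> D" and z: "pmetric (\<psi> y) z = 0" "pmetric (\<psi>u y) z = 0" "pmetric (\<psi>v y) z = 0"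
  shows "pmetric (leg e1 y) z = 0" "pmetric (leg e2 y) z = 0"
  using closed_wedge[OF leg_diff leg_diff leg_wedge leg_wedge y, of z "\<psi>u y"]
    closed_wedge[OF leg_diff leg_diff leg_wedge leg_wedge y, of z "\<psi>v y"] z frame[OF y] \<epsilon>
  by auto

definition "coeff_u X y = pmetric (leg X y) (\<psi>u y) / E y"
definition "coeff_v X y = pmetric (leg X y) (\<psi>v y) / (\<epsilon> * E y)"

lemma E_diff: "E differentiable (at y)" if "y \<in> D"
  unfolding E_def[abs_def] by (intro differentiable_pmetric diff[OF that])

lemma coeff_diff:
  assumes y: "y \<in> D"
  shows "coeff_u X differentiable (at y)" "coeff_v X differentiable (at y)"
  unfolding coeff_u_def[abs_def] coeff_v_def[abs_def] using frame(9)[OF y] \<epsilon>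
  by (intro differentiable_divide differentiable_mult differentiable_pmetric leg_diff diff
    E_diff y differentiable_const; simp)+

lemma \<eta>_decomp:
  assumes y: "y \<in> D" and X: "X = e1 \<or> X = e2"
  shows "\<eta> y X w = wedge (\<psi> y) (coeff_u X y *\<^sub>R \<psi>u y + coeff_v X y *\<^sub>R \<psi>v y) w"
proof -
  obtain c where "leg X y = coeff_u X y *\<^sub>R \<psi>u y + coeff_v X y *\<^sub>R \<psi>v y + c *\<^sub>R \<psi> y"
    using tangent_decomp[OF y leg_perp[OF y]] leg_tangent[OF y] X unfolding coeff_u_def coeff_v_def by metis
  then show ?thesis by (simp add: leg_wedge[OF y] wedge_add_multiple)
qed

text \<open>
  As an endomorphism of the tangent plane modulo \<open>\<psi>\<close>, the form is trace-free and symmetric with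
  respect to the induced conformal structure. The first comes from the component of \<open>closed_wedge\<close>
  in the tangent plane, the second from its component along \<open>\<psi>\<close>, where the derivatives of the legs
  are traded for derivatives of \<open>\<psi>\<close>.
\<close>
lemma coefficient_symmetries:
  assumes y: "y \<in> D"
  shows "coeff_v e2 y = - coeff_u e1 y" "coeff_u e2 y = \<epsilon> * coeff_v e1 y"
proof -
  let ?v = "\<lambda>X y. coeff_u X y *\<^sub>R \<psi>u y + coeff_v X y *\<^sub>R \<psi>v y"
  have diff': "?v X differentiable (at z)" if "z \<in> D" for X z
    by (intro differentiable_add differentiable_scaleR coeff_diff diff that)
  note closed = closed_wedge[of "?v e1" "?v e2", OF diff' diff' \<eta>_decomp \<eta>_decomp y]
  show "coeff_v e2 y = - coeff_u e1 y"
  proof -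
    have "(coeff_v e2 y + coeff_u e1 y) * (\<epsilon> * (E y * E y)) = 0"
      using closed[of "\<psi>u y" "\<psi>v y"] frame[OF y] by (simp add: pmetric_linear algebra_simps)
    then show ?thesis using frame(9)[OF y] \<epsilon>(1) by simp
  qed
  have "pmetric (\<psi> y) (partial_u (?v e2) y) = - pmetric (\<psi>u y) (?v e2 y)"
    "pmetric (\<psi> y) (partial_v (?v e1) y) = - pmetric (\<psi>v y) (?v e1 y)"
    unfolding partial_u_def partial_v_def
    by (intro perp_derivative y diff diff'; simp add: frame pmetric_linear
        flip: partial_u_def partial_v_def)+
  then show "coeff_u e2 y = \<epsilon> * coeff_v e1 y"
    using closed[of "\<psi> y" \<xi>] frame[OF y] transversal[OF y]
    by (simp add: pmetric_linear pmetric_commute[of "partial_u (?v e2) y" "\<psi> y"]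
        pmetric_commute[of "partial_v (?v e1) y" "\<psi> y"])
qed

lemma dderiv_tangent_frame:
  assumes y: "y \<in> D"
  shows "dderiv X \<psi> y = X $ 1 *\<^sub>R \<psi>u y + X $ 2 *\<^sub>R \<psi>v y"
    and "dderiv X \<psi>u y = X $ 1 *\<^sub>R \<psi>uu y + X $ 2 *\<^sub>R \<psi>uv y"
    and "dderiv X \<psi>v y = X $ 1 *\<^sub>R \<psi>uv y + X $ 2 *\<^sub>R \<psi>vv y"
proof -
  note expand = linear_real2[OF linear_dderiv, where X = X]
  show "dderiv X \<psi> y = X $ 1 *\<^sub>R \<psi>u y + X $ 2 *\<^sub>R \<psi>v y"
    using expand[OF diff(1)[OF y]] by (simp add: partial_u_def partial_v_def)
  show "dderiv X \<psi>u y = X $ 1 *\<^sub>R \<psi>uu y + X $ 2 *\<^sub>R \<psi>uv y"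
    using expand[OF diff(2)[OF y]]
    by (simp only: mixed[OF y, symmetric] partial_u_apply[of "partial_u \<psi>"] partial_v_apply[of "partial_u \<psi>"])
  show "dderiv X \<psi>v y = X $ 1 *\<^sub>R \<psi>uv y + X $ 2 *\<^sub>R \<psi>vv y"
    using expand[OF diff(3)[OF y]]
    by (simp only: partial_u_apply[of "partial_v \<psi>"] partial_v_apply[of "partial_v \<psi>"])
qed

lemma dderiv_twice:
  assumes y: "y \<in> D"
  shows "dderiv X (dderiv Y \<psi>) y = (X $ 1 * Y $ 1) *\<^sub>R \<psi>uu y
    + (X $ 1 * Y $ 2 + X $ 2 * Y $ 1) *\<^sub>R \<psi>uv y + (X $ 2 * Y $ 2) *\<^sub>R \<psi>vv y"
proof -
  have "dderiv X (dderiv Y \<psi>) y = dderiv X (\<lambda>z. Y $ 1 *\<^sub>R \<psi>u z + Y $ 2 *\<^sub>R \<psi>v z) y"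
    by (rule dderiv_cong[OF open_D y dderiv_tangent_frame(1)])
  also have "\<dots> = Y $ 1 *\<^sub>R dderiv X \<psi>u y + Y $ 2 *\<^sub>R dderiv X \<psi>v y"
    using diff[OF y] by (simp add: dderiv_add dderiv_scaleR differentiable_scaleR)
  finally show ?thesis
    by (simp add: dderiv_tangent_frame[OF y] algebra_simps)
qed

text \<open>
  In curvature line coordinates the mixed derivative is tangential, so that a point is umbilic as
  soon as the two pure second derivatives agree, up to the sign \<open>\<epsilon>\<close> and modulo the tangent space.
\<close>
lemma umbilic_if_hessian_tangent:
  assumes y: "y \<in> D" and h: "\<psi>uu y - \<epsilon> *\<^sub>R \<psi>vv y \<in> tangent_space \<psi> y"
  shows "umbilic \<psi> y"
  unfolding umbilic_def
proof (intro exI[of _ "inverse (E y) *\<^sub>R \<psi>uu y"] allI)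
  fix X Y :: "real^2"
  have metric: "pmetric (dderiv X \<psi> y) (dderiv Y \<psi> y) = (X $ 1 * Y $ 1 + \<epsilon> * (X $ 2 * Y $ 2)) * E y"
    by (simp add: dderiv_tangent_frame[OF y] pmetric_linear frame[OF y] algebra_simps)
  have "dderiv X (dderiv Y \<psi>) y - pmetric (dderiv X \<psi> y) (dderiv Y \<psi> y) *\<^sub>R inverse (E y) *\<^sub>R \<psi>uu y
      = (X $ 1 * Y $ 2 + X $ 2 * Y $ 1) *\<^sub>R \<psi>uv y
        + (- \<epsilon> * (X $ 2 * Y $ 2)) *\<^sub>R (\<psi>uu y - \<epsilon> *\<^sub>R \<psi>vv y)"
    unfolding dderiv_twice[OF y] metric using frame(9)[OF y]
    by (simp add: algebra_simps \<epsilon>)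
  also have "\<dots> \<in> tangent_space \<psi> y"
    using h curvature_line[OF y] unfolding tangent_space_def by (intro span_add span_scale)
  finally show "dderiv X (dderiv Y \<psi>) y - pmetric (dderiv X \<psi> y) (dderiv Y \<psi> y) *\<^sub>R
      inverse (E y) *\<^sub>R \<psi>uu y \<in> tangent_space \<psi> y" .
qed

text \<open>
  Pairing closedness with vectors orthogonal to the tangent space yields that the form commutes with
  the second fundamental forms. An off-diagonal coefficient would force these to be multiples of the
  metric, that is, produce an umbilic.
\<close>
lemma cross_coefficients_vanish:
  assumes y: "y \<in> D"
  shows "coeff_u e2 y = 0" "coeff_v e1 y = 0"
proof -
  let ?v = "\<lambda>X y. coeff_u X y *\<^sub>R \<psi>u y + coeff_v X y *\<^sub>R \<psi>v y"
  let ?h = "\<psi>uu y - \<epsilon> *\<^sub>R \<psi>vv y"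
  have diff': "?v X differentiable (at z)" if "z \<in> D" for X z
    by (intro differentiable_add differentiable_scaleR coeff_diff diff that)
  note closed = closed_wedge[of "?v e1" "?v e2", OF diff' diff' \<eta>_decomp \<eta>_decomp y]
  have dv: "dderiv Y (?v X) y = dderiv Y (coeff_u X) y *\<^sub>R \<psi>u y + coeff_u X y *\<^sub>R dderiv Y \<psi>u y
      + (dderiv Y (coeff_v X) y *\<^sub>R \<psi>v y + coeff_v X y *\<^sub>R dderiv Y \<psi>v y)" for X Y
    using coeff_diff[OF y] diff[OF y] by (simp add: dderiv_add dderiv_scaleR differentiable_scaleR)
  have h: "coeff_u e2 y * pmetric ?h z = 0"
    if z: "pmetric (\<psi> y) z = 0" "pmetric (\<psi>u y) z = 0" "pmetric (\<psi>v y) z = 0" for z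
  proof -
    have "pmetric (partial_u (?v e2) y) z = coeff_u e2 y * pmetric (\<psi>uu y) z"
      "pmetric (partial_v (?v e1) y) z = coeff_v e1 y * pmetric (\<psi>vv y) z"
      unfolding partial_u_apply[of "?v e2"] partial_v_apply[of "?v e1"] dv dderiv_tangent_frame[OF y]
      by (simp_all add: pmetric_linear z mixed_tangent[OF y z] axis_def)
    moreover have "coeff_v e1 y = \<epsilon> * coeff_u e2 y"
      using coefficient_symmetries(2)[OF y] \<epsilon> by simp
    ultimately show ?thesis
      using closed[of \<xi> z] transversal[OF y] by (simp add: pmetric_linear z algebra_simps)
  qed
  show "coeff_u e2 y = 0"
  proof (rule ccontr)
    assume "coeff_u e2 y \<noteq> 0"
    then have perp: "pmetric ?h z = 0"
      if "pmetric (\<psi> y) z = 0" "pmetric (\<psi>u y) z = 0" "pmetric (\<psi>v y) z = 0" for z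
      using h[OF that] by simp
    have "pmetric ?h (\<psi> y) = 0"
      using hessian_normal[OF y] \<epsilon>
      by (simp add: pmetric_linear pmetric_commute[of "\<psi>uu y" "\<psi> y"] pmetric_commute[of "\<psi>vv y" "\<psi> y"])
    from tangent_decomp[OF y this perp]
    obtain c where c: "?h = (pmetric ?h (\<psi>u y) / E y) *\<^sub>R \<psi>u y
        + (pmetric ?h (\<psi>v y) / (\<epsilon> * E y)) *\<^sub>R \<psi>v y + c *\<^sub>R \<psi> y" by blast
    have "?h \<in> tangent_space \<psi> y"
      unfolding tangent_space_def by (subst c) (intro span_add span_scale span_base; simp)
    then show False using umbilic_if_hessian_tangent[OF y] not_umbilic[OF y] by blast
  qed
  then show "coeff_v e1 y = 0" using coefficient_symmetries(2)[OF y] \<epsilon> by simp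
qed

lemma \<eta>_diagonal:
  assumes y: "y \<in> D"
  shows "\<eta> y e1 w = wedge (\<psi> y) (coeff_u e1 y *\<^sub>R \<psi>u y) w"
    and "\<eta> y e2 w = wedge (\<psi> y) (- (coeff_u e1 y *\<^sub>R \<psi>v y)) w"
  using \<eta>_decomp[OF y, of e1] \<eta>_decomp[OF y, of e2] cross_coefficients_vanish[OF y]
    coefficient_symmetries[OF y] by simp_all

text \<open>
  The tangential part of closedness consists of the Cauchy-Riemann equations (or their analogue for
  an indefinite metric) of the quadratic differential of the form. Its imaginary part vanishes by the diagonal shape found above, so its
  real part is constant.
\<close>
lemma holomorphic_coefficient:
  assumes y: "y \<in> D"
  shows "dderiv X (\<lambda>z. coeff_u e1 z * E z) y = 0"
proof -
  let ?v1 = "\<lambda>z. coeff_u e1 z *\<^sub>R \<psi>u z" and ?v2 = "\<lambda>z. - (coeff_u e1 z *\<^sub>R \<psi>v z)"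
  have diff': "?v1 differentiable (at z)" "?v2 differentiable (at z)" if "z \<in> D" for z
    by (intro differentiable_scaleR differentiable_minus coeff_diff diff that)+
  note closed = closed_wedge[of ?v1 ?v2, OF diff' \<eta>_diagonal y]
  have d: "partial_u ?v2 y = - (dderiv e1 (coeff_u e1) y *\<^sub>R \<psi>v y + coeff_u e1 y *\<^sub>R \<psi>uv y)"
    "partial_v ?v1 y = dderiv e2 (coeff_u e1) y *\<^sub>R \<psi>u y + coeff_u e1 y *\<^sub>R \<psi>uv y"
    using coeff_diff[OF y] diff[OF y] unfolding partial_u_apply[of ?v2] partial_v_apply[of ?v1]
    by (simp_all add: dderiv_scaleR dderiv_minus differentiable_minus dderiv_tangent_frame[OF y]
        axis_def algebra_simps)
  have dE: "dderiv e2 E y = 2 * pmetric (\<psi>uv y) (\<psi>u y)"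
    unfolding E_def[abs_def] using diff[OF y]
    by (simp add: dderiv_pmetric dderiv_tangent_frame[OF y] axis_def pmetric_commute)
  have "\<epsilon> * dderiv e1 E y = dderiv e1 (\<lambda>z. \<epsilon> * E z) y"
    using E_diff[OF y] by (simp add: dderiv_mult)
  also have "\<dots> = dderiv e1 (\<lambda>z. pmetric (\<psi>v z) (\<psi>v z)) y"
    by (rule dderiv_cong[OF open_D y]) (simp add: frame)
  also have "\<dots> = 2 * pmetric (\<psi>uv y) (\<psi>v y)"
    using diff[OF y] by (simp add: dderiv_pmetric dderiv_tangent_frame[OF y] axis_def pmetric_commute)
  finally have dE': "dderiv e1 E y = \<epsilon> * (2 * pmetric (\<psi>uv y) (\<psi>v y))"
    using \<epsilon> by (metis mult.assoc mult_1)
  have "pmetric (\<psi> y) \<xi> * (dderiv e2 (coeff_u e1) y * E y + 2 * coeff_u e1 y * pmetric (\<psi>uv y) (\<psi>u y)) = 0"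
    using closed[of "\<psi>u y" \<xi>] by (simp add: d pmetric_linear frame[OF y] algebra_simps)
  then have "dderiv e2 (coeff_u e1) y * E y + 2 * coeff_u e1 y * pmetric (\<psi>uv y) (\<psi>u y) = 0"
    using transversal[OF y] by simp
  then have 2: "dderiv e2 (\<lambda>z. coeff_u e1 z * E z) y = 0"
    using coeff_diff[OF y] E_diff[OF y] by (simp add: dderiv_mult dE)
  have "pmetric (\<psi> y) \<xi> * (dderiv e1 (coeff_u e1) y * (\<epsilon> * E y) + 2 * coeff_u e1 y * pmetric (\<psi>uv y) (\<psi>v y)) = 0"
    using closed[of "\<psi>v y" \<xi>] by (simp add: d pmetric_linear frame[OF y] algebra_simps)
  then have "dderiv e1 (coeff_u e1) y * (\<epsilon> * E y) + 2 * coeff_u e1 y * pmetric (\<psi>uv y) (\<psi>v y) = 0"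
    using transversal[OF y] by simp
  then have "\<epsilon> * (dderiv e1 (coeff_u e1) y * (\<epsilon> * E y) + 2 * coeff_u e1 y * pmetric (\<psi>uv y) (\<psi>v y)) = 0"
    by simp
  then have 1: "dderiv e1 (\<lambda>z. coeff_u e1 z * E z) y = 0"
    using coeff_diff[OF y] E_diff[OF y] by (simp add: dderiv_mult dE' algebra_simps \<epsilon>)
  show ?thesis
    using linear_real2[OF linear_dderiv, of "\<lambda>z. coeff_u e1 z * E z" y X] coeff_diff[OF y] E_diff[OF y] 1 2
    by simp
qed

text \<open>
  The isothermic form is a constant multiple of the classical one. The opposite signs in the two
  coordinate directions are what the vanishing argument for the top coefficient rests on.
\<close>
lemma form_structure:
  obtains k where "\<And>y w. y \<in> D \<Longrightarrow> \<eta> y e1 w = (k / E y) *\<^sub>R wedge (\<psi> y) (\<psi>u y) w"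
    and "\<And>y w. y \<in> D \<Longrightarrow> \<eta> y e2 w = - (k / E y) *\<^sub>R wedge (\<psi> y) (\<psi>v y) w"
proof -
  have "\<exists>k. \<forall>y\<in>D. coeff_u e1 y * E y = k"
  proof (rule has_derivative_zero_constant[OF convex_D])
    fix y assume y: "y \<in> D"
    have "(\<lambda>z. coeff_u e1 z * E z) differentiable (at y)"
      using coeff_diff[OF y] E_diff[OF y] by simp
    from has_derivative_dderiv[OF this]
    show "((\<lambda>z. coeff_u e1 z * E z) has_derivative (\<lambda>h. 0)) (at y within D)"
      by (simp add: holomorphic_coefficient[OF y] has_derivative_at_withinI)
  qed
  then obtain k where "\<forall>y\<in>D. coeff_u e1 y * E y = k" ..
  then have "coeff_u e1 y = k / E y" if "y \<in> D" for y
    using frame(9)[OF that] that by (simp add: field_simps)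
  then show thesis
    using that[of k] \<eta>_diagonal by (simp add: wedge_scaleR_right wedge_minus_right)
qed

lemma form_structure_nonzero:
  assumes "y0 \<in> D" "\<eta> y0 X0 w0 \<noteq> 0"
  obtains k where "k \<noteq> 0" "\<And>y w. y \<in> D \<Longrightarrow> \<eta> y e1 w = (k / E y) *\<^sub>R wedge (\<psi> y) (\<psi>u y) w"
    and "\<And>y w. y \<in> D \<Longrightarrow> \<eta> y e2 w = - (k / E y) *\<^sub>R wedge (\<psi> y) (\<psi>v y) w"
proof -
  obtain k where k: "\<And>y w. y \<in> D \<Longrightarrow> \<eta> y e1 w = (k / E y) *\<^sub>R wedge (\<psi> y) (\<psi>u y) w"
    "\<And>y w. y \<in> D \<Longrightarrow> \<eta> y e2 w = - (k / E y) *\<^sub>R wedge (\<psi> y) (\<psi>v y) w"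
    using form_structure by blast
  have "k \<noteq> 0"
  proof
    assume "k = 0"
    then show False
      using linear_real2[OF \<eta>_linear[OF assms(1), of w0], of X0] k[OF assms(1)] assms(2) by simp
  qed
  with k show thesis using that by blast
qed

lemma form_nowhere_or_everywhere_zero:
  assumes "y \<in> D" "y' \<in> D" "\<eta> y X w \<noteq> 0"
  shows "\<exists>X w. \<eta> y' X w \<noteq> 0"
proof -
  obtain k where k: "k \<noteq> 0" "\<And>y w. y \<in> D \<Longrightarrow> \<eta> y e1 w = (k / E y) *\<^sub>R wedge (\<psi> y) (\<psi>u y) w"
    "\<And>y w. y \<in> D \<Longrightarrow> \<eta> y e2 w = - (k / E y) *\<^sub>R wedge (\<psi> y) (\<psi>v y) w"
    using form_structure_nonzero[OF assms(1,3)] by blast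
  have "\<psi> y' \<noteq> 0" using transversal[OF assms(2)] by auto
  then have "\<eta> y' e1 (\<psi>u y') \<noteq> 0"
    using k(2)[OF assms(2)] k(1) frame[OF assms(2)] by (simp add: wedge_def)
  then show ?thesis by blast
qed

section \<open>The top coefficient of a conserved quantity\<close>

lemma annihilated_perp:
  assumes nz: "y0 \<in> D" "\<eta> y0 X0 w0 \<noteq> 0" and y: "y \<in> D" and ann: "\<And>X. \<eta> y X W = 0"
  shows "pmetric (\<psi> y) W = 0" "pmetric (\<psi>u y) W = 0" "pmetric (\<psi>v y) W = 0"
proof -
  obtain k where k: "k \<noteq> 0" "\<And>y w. y \<in> D \<Longrightarrow> \<eta> y e1 w = (k / E y) *\<^sub>R wedge (\<psi> y) (\<psi>u y) w"
    "\<And>y w. y \<in> D \<Longrightarrow> \<eta> y e2 w = - (k / E y) *\<^sub>R wedge (\<psi> y) (\<psi>v y) w"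
    using form_structure_nonzero[OF nz] by blast
  have 1: "pmetric (\<psi> y) W *\<^sub>R \<psi>u y - pmetric (\<psi>u y) W *\<^sub>R \<psi> y = 0"
    and 2: "pmetric (\<psi> y) W *\<^sub>R \<psi>v y - pmetric (\<psi>v y) W *\<^sub>R \<psi> y = 0"
    using k(2)[OF y, of W] k(3)[OF y, of W] ann[of e1] ann[of e2] k(1) frame(9)[OF y]
    by (simp_all add: wedge_def)
  from 1 have "pmetric (pmetric (\<psi> y) W *\<^sub>R \<psi>u y - pmetric (\<psi>u y) W *\<^sub>R \<psi> y) (\<psi>u y) = 0"
    by (simp only: pmetric_zero_left)
  then show *: "pmetric (\<psi> y) W = 0" using frame[OF y] by (simp add: pmetric_linear)
  have "\<psi> y \<noteq> 0" using transversal[OF y] by auto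
  then show "pmetric (\<psi>u y) W = 0" "pmetric (\<psi>v y) W = 0" using 1 2 * by simp_all
qed

text \<open>
  Here \<open>W\<close> plays the role of the top coefficient of a conserved quantity and \<open>q\<close> that of the coefficient below it.

  \<open>W\<close> is orthogonal to the tangent space and changes only tangentially, so that modulo \<open>\<psi>\<close> it is
  a parallel section of the normal bundle. Concretely, subtracting the multiple \<open>g\<close> of \<open>\<psi>\<close> that makes
  the product with \<open>\<xi>\<close> vanish leaves a map \<open>V\<close> which solves a linear differential equation. As \<open>V\<close>
  vanishes at one point, it vanishes throughout and \<open>W = g \<psi>\<close>. The derivative of \<open>W\<close> is then \<open>g\<close>
  times that of \<open>\<psi>\<close> modulo \<open>\<psi>\<close>, which has trace \<open>2 g\<close>, while it is also trace-free, being a value of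
  the form. Hence \<open>g = 0\<close>.
\<close>
lemma annihilated_section_vanishes:
  assumes nz: "y0 \<in> D" "\<eta> y0 X0 w0 \<noteq> 0"
    and W: "\<And>z. z \<in> D \<Longrightarrow> W differentiable (at z)"
    and ann: "\<And>z X. z \<in> D \<Longrightarrow> \<eta> z X (W z) = 0"
    and dW: "\<And>z X. z \<in> D \<Longrightarrow> dderiv X W z = - \<eta> z X (q z)"
    and y1: "y1 \<in> D" "W y1 \<in> span {\<psi> y1}" and y: "y \<in> D"
  shows "W y = 0"
proof -
  obtain k where k: "k \<noteq> 0" "\<And>y w. y \<in> D \<Longrightarrow> \<eta> y e1 w = (k / E y) *\<^sub>R wedge (\<psi> y) (\<psi>u y) w"
    "\<And>y w. y \<in> D \<Longrightarrow> \<eta> y e2 w = - (k / E y) *\<^sub>R wedge (\<psi> y) (\<psi>v y) w"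
    using form_structure_nonzero[OF nz] by blast
  note perp = annihilated_perp[OF nz _ ann]
  define a where "a z = k / E z * pmetric (\<psi> z) (q z)" for z
  define b where "b z = k / E z * pmetric (\<psi>u z) (q z)" for z
  define b' where "b' z = k / E z * pmetric (\<psi>v z) (q z)" for z
  have dW1: "partial_u W z = b z *\<^sub>R \<psi> z - a z *\<^sub>R \<psi>u z"
    and dW2: "partial_v W z = a z *\<^sub>R \<psi>v z - b' z *\<^sub>R \<psi> z" if "z \<in> D" for z
    using k(2,3)[OF that, of "q z"] by (simp_all add: partial_u_apply[of W] partial_v_apply[of W] dW[OF that] a_def b_def b'_def wedge_def algebra_simps)
  \<comment> \<open>Differentiating the orthogonality to \<open>\<psi>u\<close> and \<open>\<psi>v\<close> expresses \<open>a\<close>, and with it the derivative, by \<open>W\<close>.\<close>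
  have aE: "pmetric (W z) (\<psi>uu z) = a z * E z" "pmetric (W z) (\<psi>vv z) = - (a z * (\<epsilon> * E z))"
    if z: "z \<in> D" for z
  proof -
    have p: "pmetric (W z') (\<psi>u z') = 0" "pmetric (W z') (\<psi>v z') = 0" if "z' \<in> D" for z'
      using perp[OF that that] by (simp_all add: pmetric_commute)
    show "pmetric (W z) (\<psi>uu z) = a z * E z" "pmetric (W z) (\<psi>vv z) = - (a z * (\<epsilon> * E z))"
      using perp_derivative[OF z W[OF z] diff(2)[OF z] p(1), of e1]
        perp_derivative[OF z W[OF z] diff(3)[OF z] p(2), of e2] frame[OF z]
      by (simp_all add: dW1[OF z] dW2[OF z] pmetric_linear
          partial_u_apply[of W, symmetric] partial_v_apply[of W, symmetric] partial_u_apply[of \<psi>u, symmetric] partial_v_apply[of \<psi>v, symmetric])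
  qed
  define g where "g z = inverse (pmetric (\<psi> z) \<xi>) * pmetric (W z) \<xi>" for z
  define V where "V z = W z - g z *\<^sub>R \<psi> z" for z
  have g: "g differentiable (at z)" if "z \<in> D" for z
    unfolding g_def[abs_def] using transversal[OF that]
    by (intro differentiable_mult differentiable_inverse differentiable_pmetric diff[OF that] W[OF that])
      simp_all
  have V: "V differentiable (at z)" if "z \<in> D" for z
    unfolding V_def[abs_def] using diff[OF that] W[OF that] g[OF that]
    by (intro differentiable_diff differentiable_scaleR)
  have V\<xi>: "pmetric (V z) \<xi> = 0" if "z \<in> D" for z
    using transversal[OF that] by (simp add: V_def g_def pmetric_linear)
  have dV\<xi>: "pmetric (dderiv X V z) \<xi> = 0" if "z \<in> D" for X z
    using perp_derivative[OF that V[OF that] _ V\<xi>, of X] by simp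
  have dV: "dderiv X V z = dderiv X W z - (dderiv X g z *\<^sub>R \<psi> z + g z *\<^sub>R dderiv X \<psi> z)"
    if "z \<in> D" for X z
    unfolding V_def[abs_def] using diff[OF that] W[OF that] g[OF that]
    by (simp add: dderiv_diff dderiv_scaleR differentiable_scaleR)
  \<comment> \<open>The tangent vectors corrected by multiples of \<open>\<psi>\<close> so as to be orthogonal to \<open>\<xi>\<close>, like all derivatives of \<open>V\<close>.\<close>
  define n1 where "n1 z = \<psi>u z - (pmetric (\<psi>u z) \<xi> / pmetric (\<psi> z) \<xi>) *\<^sub>R \<psi> z" for z
  define n2 where "n2 z = \<psi>v z - (pmetric (\<psi>v z) \<xi> / pmetric (\<psi> z) \<xi>) *\<^sub>R \<psi> z" for z
  have dV1: "dderiv e1 V z = - (pmetric (V z) (\<psi>uu z) / E z) *\<^sub>R n1 z"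
    and dV2: "dderiv e2 V z = - (pmetric (V z) (\<psi>vv z) / (\<epsilon> * E z)) *\<^sub>R n2 z" if z: "z \<in> D" for z
  proof -
    have 1: "pmetric (V z) (\<psi>uu z) / E z = a z + g z"
      and 2: "pmetric (V z) (\<psi>vv z) / (\<epsilon> * E z) = g z - a z"
      using aE[OF z] hessian_normal[OF z] frame(9)[OF z] \<epsilon>
      by (simp_all add: V_def pmetric_linear field_simps)
    define r where "r = b z - dderiv e1 g z"
    have e: "dderiv e1 V z = r *\<^sub>R \<psi> z - (a z + g z) *\<^sub>R \<psi>u z"
      by (simp add: dV[OF z] dW1[OF z] r_def algebra_simps
          partial_u_apply[of \<psi>, symmetric] partial_u_apply[of W, symmetric])
    then have "r * pmetric (\<psi> z) \<xi> = (a z + g z) * pmetric (\<psi>u z) \<xi>"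
      using dV\<xi>[OF z, of e1] by (simp add: pmetric_linear)
    then have "r = (a z + g z) * (pmetric (\<psi>u z) \<xi> / pmetric (\<psi> z) \<xi>)"
      using transversal[OF z] by (simp add: field_simps)
    then show "dderiv e1 V z = - (pmetric (V z) (\<psi>uu z) / E z) *\<^sub>R n1 z"
      unfolding 1 e n1_def scaleR_minus_left by (simp add: scaleR_diff_right)
    define r' where "r' = - b' z - dderiv e2 g z"
    have e': "dderiv e2 V z = r' *\<^sub>R \<psi> z - (g z - a z) *\<^sub>R \<psi>v z"
      by (simp add: dV[OF z] dW2[OF z] r'_def algebra_simps
          partial_v_apply[of \<psi>, symmetric] partial_v_apply[of W, symmetric])
    then have "r' * pmetric (\<psi> z) \<xi> = (g z - a z) * pmetric (\<psi>v z) \<xi>"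
      using dV\<xi>[OF z, of e2] by (simp add: pmetric_linear)
    then have "r' = (g z - a z) * (pmetric (\<psi>v z) \<xi> / pmetric (\<psi> z) \<xi>)"
      using transversal[OF z] by (simp add: field_simps)
    then show "dderiv e2 V z = - (pmetric (V z) (\<psi>vv z) / (\<epsilon> * E z)) *\<^sub>R n2 z"
      unfolding 2 e' n2_def scaleR_minus_left by (simp add: scaleR_diff_right)
  qed
  define C where "C z = norm (\<psi>uu z) / \<bar>E z\<bar> * norm (n1 z) + norm (\<psi>vv z) / \<bar>E z\<bar> * norm (n2 z)" for z
  have bound: "norm (dderiv X V z) \<le> C z * norm X * norm (V z)" if z: "z \<in> D" for z X
  proof -
    have abs\<epsilon>: "\<bar>\<epsilon>\<bar> = 1" using sign by auto
    have 1: "norm (dderiv e1 V z) \<le> norm (\<psi>uu z) / \<bar>E z\<bar> * norm (n1 z) * norm (V z)"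
    proof -
      have "norm (dderiv e1 V z) = \<bar>pmetric (V z) (\<psi>uu z)\<bar> * (norm (n1 z) / \<bar>E z\<bar>)"
        by (simp add: dV1[OF z] abs_divide)
      also have "\<dots> \<le> (norm (V z) * norm (\<psi>uu z)) * (norm (n1 z) / \<bar>E z\<bar>)"
        by (intro mult_right_mono norm_pmetric_le) simp
      finally show ?thesis by (simp add: mult_ac)
    qed
    have 2: "norm (dderiv e2 V z) \<le> norm (\<psi>vv z) / \<bar>E z\<bar> * norm (n2 z) * norm (V z)"
    proof -
      have "norm (dderiv e2 V z) = \<bar>pmetric (V z) (\<psi>vv z)\<bar> * (norm (n2 z) / \<bar>E z\<bar>)"
        by (simp add: dV2[OF z] abs_divide abs_mult abs\<epsilon>)
      also have "\<dots> \<le> (norm (V z) * norm (\<psi>vv z)) * (norm (n2 z) / \<bar>E z\<bar>)"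
        by (intro mult_right_mono norm_pmetric_le) simp
      finally show ?thesis by (simp add: mult_ac)
    qed
    have "dderiv X V z = X $ 1 *\<^sub>R dderiv e1 V z + X $ 2 *\<^sub>R dderiv e2 V z"
      by (rule linear_real2[OF linear_dderiv[OF V[OF z]]])
    then have "norm (dderiv X V z) \<le> \<bar>X $ 1\<bar> * norm (dderiv e1 V z) + \<bar>X $ 2\<bar> * norm (dderiv e2 V z)"
      using norm_triangle_ineq[of "X $ 1 *\<^sub>R dderiv e1 V z" "X $ 2 *\<^sub>R dderiv e2 V z"] by simp
    also have "\<dots> \<le> norm X * (norm (\<psi>uu z) / \<bar>E z\<bar> * norm (n1 z) * norm (V z))
        + norm X * (norm (\<psi>vv z) / \<bar>E z\<bar> * norm (n2 z) * norm (V z))"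
      using 1 2 by (intro add_mono mult_mono component_le_norm_cart) auto
    finally show ?thesis by (simp add: C_def algebra_simps)
  qed
  have "continuous_on D C"
    unfolding C_def[abs_def] n1_def n2_def E_def
    using transversal conformal(1)
    by (intro continuous_intros continuous_on_pmetric smooth_on_continuous smooth smooth_derivs) auto
  moreover have "V y1 = 0"
  proof -
    obtain c where "W y1 = c *\<^sub>R \<psi> y1" using y1(2) by (auto simp: span_singleton)
    then show ?thesis using transversal[OF y1(1)] by (simp add: V_def g_def pmetric_linear)
  qed
  ultimately have V0: "V z = 0" if "z \<in> D" for z
    using gronwall_vanishing[OF convex_D y1(1) that V _ bound] by blast
  have dV0: "dderiv X V y = 0" for X
  proof -
    have "dderiv X V y = dderiv X (\<lambda>z. 0) y" by (rule dderiv_cong[OF open_D y V0])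
    then show ?thesis by simp
  qed
  have "(a y + g y) * E y = 0" "(g y - a y) * (\<epsilon> * E y) = 0"
  proof -
    have "pmetric (dderiv e1 V y) (\<psi>u y) = 0" "pmetric (dderiv e2 V y) (\<psi>v y) = 0"
      by (simp_all add: dV0)
    then show "(a y + g y) * E y = 0" "(g y - a y) * (\<epsilon> * E y) = 0"
      using \<epsilon>(1) by (auto simp: dV[OF y] dW1[OF y] dW2[OF y] pmetric_linear frame[OF y] algebra_simps
          partial_u_apply[of \<psi>, symmetric] partial_u_apply[of W, symmetric]
          partial_v_apply[of \<psi>, symmetric] partial_v_apply[of W, symmetric])
  qed
  then have "g y = 0" using frame(9)[OF y] \<epsilon>(1) by auto
  then show ?thesis using V0[OF y] by (simp add: V_def)
qed

end

text \<open>
  The coefficients of \<open>t ^ (d + 1)\<close> and \<open>t ^ d\<close> in the equation that makes \<open>p(t)\<close>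
  parallel, which holds for all \<open>t\<close>. There is no
  coefficient below the top one when the degree is 0.
\<close>
lemma conserved_coefficients:
  assumes cq: "conserved_quantity \<Sigma> \<A> d \<eta> p" and form: "is_one_form \<A> \<eta>"
    and c: "(D, \<kappa>) \<in> \<A>" "y \<in> D"
  shows "\<eta> (D, \<kappa>) y X (p (\<kappa> y) d) = 0"
    and "dderiv X (\<lambda>z. p (\<kappa> z) d) y = - \<eta> (D, \<kappa>) y X (case d of 0 \<Rightarrow> 0 | Suc e \<Rightarrow> p (\<kappa> y) e)"
proof -
  let ?h = "\<eta> (D, \<kappa>) y X" and ?p = "\<lambda>k z. p (\<kappa> z) k"
  have lin: "linear ?h" using form c by (fastforce simp: is_one_form_def)
  interpret h: linear ?h by (rule lin)
  have diff: "?p k differentiable (at y)" if "k \<le> d" for k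
    using cq c that smooth_on_differentiable unfolding conserved_quantity_def by fastforce
  have deriv: "dderiv X (\<lambda>z. poly_eval d (p (\<kappa> z)) t) y = poly_eval d (\<lambda>k. dderiv X (?p k) y) t" for t
    unfolding poly_eval_def
    by (rule dderiv_eqI[OF has_derivative_sum[OF has_derivative_scaleR_right[OF has_derivative_dderiv[OF diff]]]])
      simp
  have eval: "?h (poly_eval d (p (\<kappa> y)) t) = poly_eval d (\<lambda>k. ?h (p (\<kappa> y) k)) t" for t
    by (simp add: poly_eval_def h.sum h.scale)
  define c1 where "c1 k = (if k \<le> d then dderiv X (?p k) y else 0)" for k
  define c2 where "c2 k = (case k of 0 \<Rightarrow> 0 | Suc j \<Rightarrow> ?h (p (\<kappa> y) j))" for k
  have "poly_eval (Suc d) (\<lambda>k. c1 k + c2 k) t = poly_eval (Suc d) (\<lambda>k. 0) t" for t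
  proof -
    have "poly_eval (Suc d) (\<lambda>k. c1 k + c2 k) t = poly_eval (Suc d) c1 t + poly_eval (Suc d) c2 t"
      by (simp only: poly_eval_def scaleR_add_right sum.distrib)
    moreover have "poly_eval (Suc d) c1 t = poly_eval d (\<lambda>k. dderiv X (?p k) y) t"
      by (simp add: poly_eval_def c1_def)
    moreover have "poly_eval (Suc d) c2 t = t *\<^sub>R poly_eval d (\<lambda>k. ?h (p (\<kappa> y) k)) t"
      unfolding poly_eval_def sum.atMost_Suc_shift by (simp add: c2_def scaleR_sum_right)
    moreover have "connection (\<eta> (D, \<kappa>)) t (\<lambda>z. poly_eval d (p (\<kappa> z)) t) y X = 0"
      using cq c unfolding conserved_quantity_def by fast
    ultimately show ?thesis
      by (simp add: connection_def deriv eval) (simp add: poly_eval_def)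
  qed
  then have zero: "c1 k + c2 k = 0" if "k \<le> Suc d" for k
    using poly_eval_unique[of 0 "Suc d" "\<lambda>k. c1 k + c2 k" "\<lambda>k. 0" k] that by blast
  show "?h (p (\<kappa> y) d) = 0" using zero[of "Suc d"] by (simp add: c1_def c2_def)
  show "dderiv X (?p d) y = - ?h (case d of 0 \<Rightarrow> 0 | Suc e \<Rightarrow> p (\<kappa> y) e)"
    using zero[of d] by (cases d) (simp_all add: c1_def c2_def h.zero eq_neg_iff_add_eq_0)
qed

lemma chart_inverse:
  assumes "is_chart \<Sigma> (D, \<kappa>)" "y \<in> D"
  shows "inv_into D \<kappa> (\<kappa> y) = y"
  using assms by (auto simp: is_chart_def homeomorphism_def)

lemma nonzero_form_other_chart:
  assumes atlas: "is_atlas \<Sigma> \<A>" and form: "is_one_form \<A> \<eta>"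
    and c: "(D, \<kappa>) \<in> \<A>" "y \<in> D" and c': "(D', \<kappa>') \<in> \<A>" "y' \<in> D'" and eq: "\<kappa> y = \<kappa>' y'"
    and nz: "\<eta> (D', \<kappa>') y' X w \<noteq> 0"
  shows "\<exists>X w. \<eta> (D, \<kappa>) y X w \<noteq> 0"
proof -
  have "is_chart \<Sigma> (D, \<kappa>)" using atlas c(1) by (auto simp: is_atlas_def)
  then have tr: "transition (D', \<kappa>') (D, \<kappa>) y' = y"
    using chart_inverse c(2) by (simp add: transition_def eq[symmetric])
  have "y' \<in> overlap (D', \<kappa>') (D, \<kappa>)"
    using c c' by (auto simp: overlap_def eq[symmetric])
  then have "\<eta> (D', \<kappa>') y' X
      = \<eta> (D, \<kappa>) (transition (D', \<kappa>') (D, \<kappa>) y') (dderiv X (transition (D', \<kappa>') (D, \<kappa>)) y')"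
    using form c(1) c'(1) unfolding is_one_form_def by blast
  then show ?thesis using nz unfolding tr by metis
qed

text \<open>
  A small ball in a curvature line chart: a vector not orthogonal to the lift at the centre remains
  so nearby.
\<close>
lemma isothermic_patch_at:
  fixes f :: "'s::{t2_space, second_countable_topology} \<Rightarrow> ('p::finite, 'q::finite) ambient set"
  assumes atlas: "is_atlas \<Sigma> \<A>" and iso: "isothermic \<Sigma> \<A> f" and form: "isothermic_form \<A> f \<eta>"
    and x: "x \<in> \<Sigma>"
  obtains D \<kappa> B \<psi> \<epsilon> \<xi> where "(D, \<kappa>) \<in> \<A>" "B \<subseteq> D" "x \<in> \<kappa> ` B" "openin (top_of_set \<Sigma>) (\<kappa> ` B)"
    "isothermic_patch B \<psi> \<epsilon> \<xi> (\<eta> (D, \<kappa>))" "\<And>y. y \<in> B \<Longrightarrow> f (\<kappa> y) = span {\<psi> y}"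
proof -
  obtain D \<kappa> \<psi> where c: "(D, \<kappa>) \<in> \<A>" and x': "x \<in> \<kappa> ` D" and lift: "lift_on D (f \<circ> \<kappa>) \<psi>"
    and ccl: "conformal_curvature_line D \<psi>"
    using iso x unfolding isothermic_def by fast
  obtain y0 where y0: "y0 \<in> D" "x = \<kappa> y0" using x' by blast
  have D: "open D" "smooth_on D \<psi>" and cone: "\<And>y. y \<in> D \<Longrightarrow> \<psi> y \<in> light_cone"
    and span: "\<And>y. y \<in> D \<Longrightarrow> f (\<kappa> y) = span {\<psi> y}"
    using lift by (auto simp: lift_on_def)
  obtain \<epsilon> where sign: "\<epsilon> \<in> {1, -1}" and ccl': "\<And>y. y \<in> D \<Longrightarrow> pmetric (partial_u \<psi> y) (partial_u \<psi> y) \<noteq> 0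
     \<and> pmetric (partial_v \<psi> y) (partial_v \<psi> y) = \<epsilon> * pmetric (partial_u \<psi> y) (partial_u \<psi> y)
     \<and> pmetric (partial_u \<psi> y) (partial_v \<psi> y) = 0
     \<and> partial_u (partial_v \<psi>) y \<in> tangent_space \<psi> y"
    using ccl unfolding conformal_curvature_line_def by blast
  have "\<psi> y0 \<noteq> 0" using cone[OF y0(1)] by (simp add: light_cone_def)
  then obtain \<xi> where \<xi>: "pmetric (\<psi> y0) \<xi> \<noteq> 0" by (rule pmetric_dual_vector)
  have "continuous_on D (\<lambda>y. pmetric (\<psi> y) \<xi>)"
    by (intro continuous_on_pmetric smooth_on_continuous D continuous_on_const)
  then have "open (D \<inter> (\<lambda>y. pmetric (\<psi> y) \<xi>) -` (- {0}))"
    by (rule continuous_open_preimage) (use D in auto)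
  then obtain r where r: "r > 0" "ball y0 r \<subseteq> D \<inter> (\<lambda>y. pmetric (\<psi> y) \<xi>) -` (- {0})"
    using y0(1) \<xi> by (auto elim!: openE)
  define B where "B = ball y0 r"
  have B: "open B" "convex B" "B \<subseteq> D" "\<And>y. y \<in> B \<Longrightarrow> pmetric (\<psi> y) \<xi> \<noteq> 0" "y0 \<in> B"
    using r by (auto simp: B_def)
  have nu: "\<not> umbilic \<psi> y" if "y \<in> D" for y
    using iso c lift that unfolding isothermic_def umbilic_free_def by fast
  have one: "is_one_form \<A> \<eta>" and closed: "closed_form \<A> \<eta>"
    and wedge: "\<And>y X. y \<in> D \<Longrightarrow> \<eta> (D, \<kappa>) y X \<in> wedge_perp (f (\<kappa> y))"
    using form c unfolding isothermic_form_def by blast+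
  have patch: "isothermic_patch B \<psi> \<epsilon> \<xi> (\<eta> (D, \<kappa>))"
  proof (rule isothermic_patch.intro)
    show "smooth_on B \<psi>" using D B smooth_on_subset by blast
    show "smooth_on B (\<lambda>y. \<eta> (D, \<kappa>) y X w)" for X w
    proof -
      have "smooth_on (fst (D, \<kappa>)) (\<lambda>y. \<eta> (D, \<kappa>) y X w)"
        using one c unfolding is_one_form_def by blast
      then show ?thesis using smooth_on_subset[OF B(3)] by simp
    qed
    show "linear (\<lambda>X. \<eta> (D, \<kappa>) y X w)" if "y \<in> B" for y w
    proof -
      have "y \<in> fst (D, \<kappa>)" using that B(3) by auto
      then show ?thesis using one c unfolding is_one_form_def by blast
    qed
    show "dderiv X (\<lambda>z. \<eta> (D, \<kappa>) z Y w) y = dderiv Y (\<lambda>z. \<eta> (D, \<kappa>) z X w) y" if "y \<in> B" for y X Y w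
    proof -
      have "y \<in> fst (D, \<kappa>)" using that B(3) by auto
      then show ?thesis using closed c unfolding closed_form_def by blast
    qed
    show "\<eta> (D, \<kappa>) y X \<in> wedge_perp (span {\<psi> y})" if "y \<in> B" for y X
      using wedge span B(3) that by (metis subsetD)
  qed (use B sign ccl' cone nu in \<open>auto simp: light_cone_def\<close>)
  have "openin (top_of_set \<Sigma>) (\<kappa> ` B)"
  proof -
    have chart: "homeomorphism D (\<kappa> ` D) \<kappa> (inv_into D \<kappa>)" "openin (top_of_set \<Sigma>) (\<kappa> ` D)"
      using atlas c by (auto simp: is_atlas_def is_chart_def)
    have "openin (top_of_set D) B" using B by (auto simp: openin_open)
    then have "openin (top_of_set (\<kappa> ` D)) (\<kappa> ` B)"
      using homeomorphism_imp_open_map[OF chart(1)] by blast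
    then show ?thesis using chart(2) openin_trans by blast
  qed
  then show thesis
    using that[OF c B(3) _ _ patch] B y0 span by blast
qed

lemma simply_connected_space_connected:
  fixes S :: "'a::topological_space set"
  assumes "simply_connected S" shows "connected S"
proof -
  have "path_component S a b" if "a \<in> S" "b \<in> S" for a b
  proof -
    have "homotopic_loops S (\<lambda>_. a) (\<lambda>_. b)"
      using assms[unfolded simply_connected_def, rule_format, of "\<lambda>_. a" "\<lambda>_. b"] that
      by (simp add: path_def path_image_def pathfinish_def pathstart_def image_subset_iff)
    from homotopic_loops_imp_path_component_value[OF this, of 0] show ?thesis by simp
  qed
  then show ?thesis by (intro path_connected_imp_connected) (simp add: path_connected_component)
qed

lemma connected_locally_constant:
  assumes "connected S" "a \<in> S" "b \<in> S"
    and "\<And>a. a \<in> S \<Longrightarrow> \<exists>T. openin (top_of_set S) T \<and> a \<in> T \<and> (\<forall>x\<in>T. P x = P a)"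
  shows "P a = P b"
proof (rule connected_equivalence_relation[of S a b "\<lambda>x y. P x = P y"])
  show "\<exists>T. openin (top_of_set S) T \<and> a \<in> T \<and> (\<forall>x\<in>T. P a = P x)" if "a \<in> S" for a
    using assms(4)[OF that] by metis
qed (use assms in simp_all)

text \<open>
  Two connectedness arguments. The isothermic form is nowhere zero, since on each patch it is a
  constant multiple of a nowhere vanishing form. Given this, the top coefficient vanishes on a whole
  patch as soon as it lies in the line of the surface at a single point of it, so the set of such
  points is open and closed; it is not the whole surface because the top coefficient is not
  identically zero.
\<close>
lemma top_coefficient_proper:
  fixes f :: "'s::{t2_space, second_countable_topology} \<Rightarrow> ('p::finite, 'q::finite) ambient set"
  assumes atlas: "is_atlas \<Sigma> \<A>" and conn: "connected \<Sigma>" and iso: "isothermic \<Sigma> \<A> f"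
    and form: "isothermic_form \<A> f \<eta>" and cq: "conserved_quantity \<Sigma> \<A> d \<eta> p"
    and x: "x \<in> \<Sigma>" and u: "f x = span {u}"
  shows "proper_top d (p x) u"
proof -
  note patch_at = isothermic_patch_at[OF atlas iso form]
  have one: "is_one_form \<A> \<eta>" using form by (simp add: isothermic_form_def)
  define N where "N x \<longleftrightarrow> (\<exists>D \<kappa> y X w. (D, \<kappa>) \<in> \<A> \<and> y \<in> D \<and> \<kappa> y = x \<and> \<eta> (D, \<kappa>) y X w \<noteq> 0)" for x
  have N_chart: "N (\<kappa> y) \<longleftrightarrow> (\<exists>X w. \<eta> (D, \<kappa>) y X w \<noteq> 0)" if "(D, \<kappa>) \<in> \<A>" "y \<in> D" for D \<kappa> y
    using nonzero_form_other_chart[OF atlas one that] that unfolding N_def by metis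
  have N_const: "N a = N b" if "a \<in> \<Sigma>" "b \<in> \<Sigma>" for a b
  proof (rule connected_locally_constant[OF conn that])
    fix a assume "a \<in> \<Sigma>"
    then obtain D \<kappa> B \<psi> \<epsilon> \<xi> where c: "(D, \<kappa>) \<in> \<A>" "B \<subseteq> D" "a \<in> \<kappa> ` B" "openin (top_of_set \<Sigma>) (\<kappa> ` B)"
      and patch: "isothermic_patch B \<psi> \<epsilon> \<xi> (\<eta> (D, \<kappa>))" by (rule patch_at)
    have "N x = N a" if "x \<in> \<kappa> ` B" for x
    proof -
      have "N (\<kappa> y')" if "y \<in> B" "y' \<in> B" "N (\<kappa> y)" for y y'
        using isothermic_patch.form_nowhere_or_everywhere_zero[OF patch that(1,2)] that c(2)
          N_chart[OF c(1)] by blast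
      then show ?thesis using c(3) that by blast
    qed
    then show "\<exists>T. openin (top_of_set \<Sigma>) T \<and> a \<in> T \<and> (\<forall>x\<in>T. N x = N a)" using c by blast
  qed
  have N: "N a" if "a \<in> \<Sigma>" for a
  proof -
    obtain D \<kappa> y X w where y: "(D, \<kappa>) \<in> \<A>" "y \<in> D" "\<eta> (D, \<kappa>) y X w \<noteq> 0"
      using form unfolding isothermic_form_def by force
    then have "\<kappa> y \<in> \<Sigma>" using atlas by (force simp: is_atlas_def)
    then show ?thesis using N_const[OF that] N_chart[OF y(1,2)] y(3) by blast
  qed
  define Z where "Z x \<longleftrightarrow> p x d \<in> f x" for x
  have local: "\<exists>T. openin (top_of_set \<Sigma>) T \<and> a \<in> T \<and> ((\<exists>x\<in>T. Z x) \<longrightarrow> (\<forall>x\<in>T. p x d = 0))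
      \<and> (\<forall>v. f a = span {v} \<longrightarrow> pmetric (p a d) v = 0)" if a: "a \<in> \<Sigma>" for a
  proof -
    obtain D \<kappa> B \<psi> \<epsilon> \<xi> where c: "(D, \<kappa>) \<in> \<A>" "B \<subseteq> D" "a \<in> \<kappa> ` B" "openin (top_of_set \<Sigma>) (\<kappa> ` B)"
      and patch: "isothermic_patch B \<psi> \<epsilon> \<xi> (\<eta> (D, \<kappa>))"
      and span: "\<And>y. y \<in> B \<Longrightarrow> f (\<kappa> y) = span {\<psi> y}" using patch_at[OF a] by metis
    obtain y0 where y0: "y0 \<in> B" "a = \<kappa> y0" using c(3) by blast
    then obtain X0 w0 where nz: "\<eta> (D, \<kappa>) y0 X0 w0 \<noteq> 0"
      using N[OF a] N_chart[OF c(1)] c(2) by blast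
    have D: "z \<in> D" if "z \<in> B" for z using that c(2) by blast
    note coeff = conserved_coefficients[OF cq one c(1) D]
    have smooth: "smooth_on D (\<lambda>z. p (\<kappa> z) d)"
      using cq c(1) unfolding conserved_quantity_def by fast
    have "p (\<kappa> y) d = 0" if "y1 \<in> B" "Z (\<kappa> y1)" "y \<in> B" for y y1
      by (rule isothermic_patch.annihilated_section_vanishes[OF patch y0(1) nz, where W = "\<lambda>z. p (\<kappa> z) d"])
        (use that span coeff smooth_on_differentiable[OF smooth] D in \<open>auto simp: Z_def\<close>)
    moreover have "pmetric (p a d) v = 0" if v: "f a = span {v}" for v
    proof -
      have "pmetric (\<psi> y0) (p a d) = 0"
        using isothermic_patch.annihilated_perp(1)[OF patch y0(1) nz y0(1)] coeff(1)[OF y0(1)] y0(2) by blast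
      moreover obtain r where "v = r *\<^sub>R \<psi> y0"
        using v span[OF y0(1)] y0(2) span_base[of v "{v}"] by (auto simp: span_singleton)
      ultimately show ?thesis by (simp add: pmetric_linear pmetric_commute)
    qed
    ultimately show ?thesis using c by (intro exI[of _ "\<kappa> ` B"]) auto
  qed
  have "\<not> Z x"
  proof
    assume "Z x"
    have Z0: "Z a" if "p a d = 0" "a \<in> \<Sigma>" for a
      using isothermic_patch_at[OF atlas iso form that(2)] that(1) span_zero unfolding Z_def
      by (metis imageE)
    have "Z a" if "a \<in> \<Sigma>" for a
    proof -
      have "Z x = Z a"
      proof (rule connected_locally_constant[OF conn x that])
        fix b assume "b \<in> \<Sigma>"
        from local[OF this] obtain T where T: "openin (top_of_set \<Sigma>) T" "b \<in> T"
          "(\<exists>x\<in>T. Z x) \<longrightarrow> (\<forall>x\<in>T. p x d = 0)" by blast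
        have "T \<subseteq> \<Sigma>" using T(1) openin_imp_subset by blast
        then have "Z y = Z b" if "y \<in> T" for y using T that Z0 by blast
        then show "\<exists>T. openin (top_of_set \<Sigma>) T \<and> b \<in> T \<and> (\<forall>x\<in>T. Z x = Z b)" using T by blast
      qed
      then show ?thesis using \<open>Z x\<close> by simp
    qed
    then have "p a d = 0" if "a \<in> \<Sigma>" for a using local[OF that] that by blast
    then show False using cq unfolding conserved_quantity_def by blast
  qed
  moreover have "pmetric (p x d) u = 0" using local[OF x] u by blast
  ultimately show ?thesis by (simp add: proper_top_def Z_def u)
qed

section \<open>Lattices of Baecklund transforms\<close>

lemma isothermic_null_line:
  assumes "isothermic \<Sigma> \<A> f" "x \<in> \<Sigma>"
  shows "\<exists>v. v \<in> light_cone \<and> f x = span {v}"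
proof -
  obtain D \<kappa> \<psi> y where "lift_on D (f \<circ> \<kappa>) \<psi>" "y \<in> D" "x = \<kappa> y"
    using assms unfolding isothermic_def by blast
  then have "\<psi> y \<in> light_cone \<and> f x = span {\<psi> y}" by (simp add: lift_on_def)
  then show ?thesis by blast
qed

theorem theorem2p10:
  fixes \<Sigma> :: "'s::{t2_space, second_countable_topology} set"
    and \<A> :: "'s chart set"
    and f :: "nat \<Rightarrow> nat \<Rightarrow> 's \<Rightarrow> ('p::finite, 'q::finite) ambient set"
    and d :: nat and x :: 's
  assumes "smooth_surface \<Sigma> \<A>" and "simply_connected \<Sigma>"
    and "special_isothermic \<Sigma> \<A> d (f 0 0)"
    and "baecklund_lattice \<Sigma> \<A> d f"
    and "x \<in> \<Sigma>"
  shows "discrete_special_isothermic d (\<lambda>(m, n). f m n x)"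
proof -
  obtain \<eta> :: "nat \<Rightarrow> nat \<Rightarrow> ('s, 'p, 'q) end_form" and P Q \<mu> \<nu> where PQ: "P 0 = Q 0"
    and P: "\<And>m. baecklund_transform \<Sigma> \<A> d (\<mu> m) (f m 0) (\<eta> m 0) (P m) (f (Suc m) 0) (\<eta> (Suc m) 0)"
      "\<And>m. transformed_quantity \<Sigma> d (\<mu> m) (f m 0) (f (Suc m) 0) (P m) (P (Suc m))"
    and Q: "\<And>n. baecklund_transform \<Sigma> \<A> d (\<nu> n) (f 0 n) (\<eta> 0 n) (Q n) (f 0 (Suc n)) (\<eta> 0 (Suc n))"
      "\<And>n. transformed_quantity \<Sigma> d (\<nu> n) (f 0 n) (f 0 (Suc n)) (Q n) (Q (Suc n))"
    and perm: "\<And>m n. permutability \<Sigma> \<A> (\<mu> m) (\<nu> n) (f m n) (\<eta> m n) (f (Suc m) n) (\<eta> (Suc m) n)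
              (f m (Suc n)) (\<eta> m (Suc n)) (f (Suc m) (Suc n)) (\<eta> (Suc m) (Suc n))"
    using assms(4) unfolding baecklund_lattice_def by blast
  have dar: "darboux_transform \<Sigma> \<A> (\<mu> m) (f m n) (\<eta> m n) (f (Suc m) n) (\<eta> (Suc m) n)"
    "darboux_transform \<Sigma> \<A> (\<nu> n) (f m n) (\<eta> m n) (f m (Suc n)) (\<eta> m (Suc n))" for m n
    using perm[of m n] by (simp_all add: permutability_def)
  have "\<forall>m n. \<exists>v. v \<in> light_cone \<and> f m n x = span {v}"
    using dar(1) isothermic_null_line[OF _ assms(5)] unfolding darboux_transform_def by blast
  then obtain u where u: "\<And>m n. u m n \<in> light_cone" "\<And>m n. f m n x = span {u m n}" by metis
  have "discrete_special_isothermic d (\<lambda>(m, n). span {u m n})"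
  proof (rule discrete_special_isothermic_grid[where \<mu> = \<mu> and \<nu> = \<nu>
        and P = "\<lambda>m. P m x" and Q = "\<lambda>n. Q n x"])
    show "pmetric (u m n) (u (Suc m) n) \<noteq> 0" "pmetric (u m n) (u m (Suc n)) \<noteq> 0" for m n
      using dar[where m = m and n = n] assms(5) by (auto simp: darboux_transform_def u(2) orthogonal_span_spans)
    show "\<mu> m \<noteq> 0" "\<nu> m \<noteq> 0" for m
      using dar(1)[of m 0] dar(2)[of m 0] by (simp_all add: darboux_transform_def)
    show "\<mu> m \<noteq> \<nu> n" for m n using perm[of m n] by (simp add: permutability_def)
    show "span {u (Suc m) (Suc n)}
      = boost (span {u m n}) (span {u (Suc m) n}) (1 - \<nu> n / \<mu> m) ` span {u m (Suc n)}" for m n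
      using perm[of m n] assms(5) unfolding permutability_def u(2)[symmetric] by blast
    show "edge_property d (\<mu> m) (span {u m 0}) (span {u (Suc m) 0}) (P m x) (P (Suc m) x)" for m
      using P(2)[of m] assms(5) unfolding transformed_quantity_def edge_property_def u(2)[symmetric] by blast
    show "edge_property d (\<nu> n) (span {u 0 n}) (span {u 0 (Suc n)}) (Q n x) (Q (Suc n) x)" for n
      using Q(2)[of n] assms(5) unfolding transformed_quantity_def edge_property_def u(2)[symmetric] by blast
    show "pmetric (poly_eval d (P m x) (\<mu> m)) (u (Suc m) 0) = 0" for m
      using P(1)[of m] assms(5)
      unfolding baecklund_transform_def u(2)[symmetric] orthogonal_span_single[symmetric] by blast
    show "pmetric (poly_eval d (Q n x) (\<nu> n)) (u 0 (Suc n)) = 0" for n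
      using Q(1)[of n] assms(5)
      unfolding baecklund_transform_def u(2)[symmetric] orthogonal_span_single[symmetric] by blast
    show "P 0 x = Q 0 x" by (simp add: PQ)
    show "proper_top d (P 0 x) (u 0 0)"
    proof (rule top_coefficient_proper[where f = "f 0 0" and p = "P 0" and \<eta> = "\<eta> 0 0"])
      show "is_atlas \<Sigma> \<A>" using assms(1) by (simp add: smooth_surface_def)
      show "connected \<Sigma>" using assms(2) by (rule simply_connected_space_connected)
      show "isothermic \<Sigma> \<A> (f 0 0)" "isothermic_form \<A> (f 0 0) (\<eta> 0 0)"
        using dar(1)[of 0 0] by (simp_all add: darboux_transform_def)
      show "conserved_quantity \<Sigma> \<A> d (\<eta> 0 0) (P 0)" using P(1)[of 0] by (simp add: baecklund_transform_def)
    qed (rule assms(5) u(2))+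
  qed (use u in auto)
  then show ?thesis by (simp add: u(2))
qed

end
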